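(* Let $\mathcal{A}$ be a just-infinite C*-algebra and let $\alpha:G\to\mathrm{Aut}(\mathcal{A})$ be an action of a finite group $G$ with the Rokhlin property. Then $\mathcal{A}\rtimes_\alpha G$ is just-infinite.
   Context: A C*-algebra is just-infinite if it is infinite-dimensional and every quotient by a nonzero closed two-sided ideal is finite-dimensional. An action $\alpha$ of a finite group $G$ on a C*-algebra $\mathcal{A}$ has the Rokhlin property if for every $\varepsilon>0$ and finite $\mathcal{F}\subseteq\mathcal{A}$ there are mutually orthogonal positive contractions $(r_g)_{g\in G}\subseteq\mathcal{A}$ with (1) $\|\alpha_g(r_h)-r_{gh}\|<\varepsilon$ for all $g,h\in G$; (2) $\|r_ga-ar_g\|<\varepsilon$ for all $a\in\mathcal{F}$, $g\in G$; (3) $\|(\sum_{g\in G}r_g)a-a\|<\varepsilon$ for all $a\in\mathcal{F}$. *)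

theory Defs
  imports "HOL-Analysis.Analysis" "HOL-Algebra.Group" "HOL-Library.Function_Algebras"
begin

definition cstar_algebra ::
  "(complex \<Rightarrow> 'a::{real_normed_algebra,banach} \<Rightarrow> 'a) \<Rightarrow> ('a \<Rightarrow> 'a) \<Rightarrow> bool" where
  "cstar_algebra scC st \<longleftrightarrow>
     (\<forall>r x. scC (complex_of_real r) x = scaleR r x) \<and>
     (\<forall>c x y. scC c (x + y) = scC c x + scC c y) \<and>
     (\<forall>c d x. scC (c + d) x = scC c x + scC d x) \<and>
     (\<forall>c d x. scC c (scC d x) = scC (c * d) x) \<and>
     (\<forall>c x y. scC c (x * y) = scC c x * y \<and> scC c (x * y) = x * scC c y) \<and>
     (\<forall>c x. norm (scC c x) = cmod c * norm x) \<and>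
     (\<forall>x y. st (x + y) = st x + st y) \<and>
     (\<forall>c x. st (scC c x) = scC (cnj c) (st x)) \<and>
     (\<forall>x y. st (x * y) = st y * st x) \<and>
     (\<forall>x. st (st x) = x) \<and>
     (\<forall>x. norm (st x * x) = (norm x)\<^sup>2)"

definition fin_codim :: "(complex \<Rightarrow> 'b::ab_group_add \<Rightarrow> 'b) \<Rightarrow> 'b set \<Rightarrow> 'b set \<Rightarrow> bool" where
  "fin_codim sc C I \<longleftrightarrow>
     (\<exists>S. finite S \<and> S \<subseteq> C \<and> (\<forall>x\<in>C. \<exists>c. \<exists>y\<in>I. x = (\<Sum>s\<in>S. sc (c s) s) + y))"

definition closed_ideal ::
  "'b::ab_group_add set \<Rightarrow> (complex \<Rightarrow> 'b \<Rightarrow> 'b) \<Rightarrow> ('b \<Rightarrow> 'b \<Rightarrow> 'b) \<Rightarrow> ('b \<Rightarrow> real) \<Rightarrow> 'b set \<Rightarrow> bool" where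
  "closed_ideal C sc mul nrm I \<longleftrightarrow>
     I \<subseteq> C \<and> 0 \<in> I \<and>
     (\<forall>x\<in>I. \<forall>y\<in>I. x + y \<in> I) \<and>
     (\<forall>c. \<forall>x\<in>I. sc c x \<in> I) \<and>
     (\<forall>a\<in>C. \<forall>x\<in>I. mul a x \<in> I \<and> mul x a \<in> I) \<and>
     (\<forall>X x. (\<forall>n. X n \<in> I) \<and> x \<in> C \<and> (\<lambda>n. nrm (X n - x)) \<longlonglongrightarrow> 0 \<longrightarrow> x \<in> I)"

definition just_infinite ::
  "'b::ab_group_add set \<Rightarrow> (complex \<Rightarrow> 'b \<Rightarrow> 'b) \<Rightarrow> ('b \<Rightarrow> 'b \<Rightarrow> 'b) \<Rightarrow> ('b \<Rightarrow> real) \<Rightarrow> bool" where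
  "just_infinite C sc mul nrm \<longleftrightarrow>
     \<not> fin_codim sc C {0} \<and>
     (\<forall>I. closed_ideal C sc mul nrm I \<and> I \<noteq> {0} \<longrightarrow> fin_codim sc C I)"

definition cstar_action ::
  "('g, 'm) monoid_scheme \<Rightarrow> (complex \<Rightarrow> 'a::{real_normed_algebra,banach} \<Rightarrow> 'a) \<Rightarrow> ('a \<Rightarrow> 'a)
   \<Rightarrow> ('g \<Rightarrow> 'a \<Rightarrow> 'a) \<Rightarrow> bool" where
  "cstar_action G scC st \<alpha> \<longleftrightarrow>
     (\<forall>g\<in>carrier G. bij (\<alpha> g) \<and>
        (\<forall>x y. \<alpha> g (x + y) = \<alpha> g x + \<alpha> g y) \<and>
        (\<forall>c x. \<alpha> g (scC c x) = scC c (\<alpha> g x)) \<and>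
        (\<forall>x y. \<alpha> g (x * y) = \<alpha> g x * \<alpha> g y) \<and>
        (\<forall>x. \<alpha> g (st x) = st (\<alpha> g x))) \<and>
     (\<forall>x. \<alpha> \<one>\<^bsub>G\<^esub> x = x) \<and>
     (\<forall>g\<in>carrier G. \<forall>h\<in>carrier G. \<forall>x. \<alpha> (g \<otimes>\<^bsub>G\<^esub> h) x = \<alpha> g (\<alpha> h x))"

definition positive :: "('a::times \<Rightarrow> 'a) \<Rightarrow> 'a \<Rightarrow> bool" where
  "positive st a \<longleftrightarrow> (\<exists>b. a = st b * b)"

definition rokhlin ::
  "('g, 'm) monoid_scheme \<Rightarrow> ('a \<Rightarrow> 'a) \<Rightarrow> ('g \<Rightarrow> 'a \<Rightarrow> 'a::{real_normed_algebra}) \<Rightarrow> bool" where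
  "rokhlin G st \<alpha> \<longleftrightarrow>
     (\<forall>\<epsilon>>0. \<forall>F. finite F \<longrightarrow>
        (\<exists>r. (\<forall>g\<in>carrier G. positive st (r g) \<and> norm (r g) \<le> 1) \<and>
             (\<forall>g\<in>carrier G. \<forall>h\<in>carrier G. g \<noteq> h \<longrightarrow> r g * r h = 0) \<and>
             (\<forall>g\<in>carrier G. \<forall>h\<in>carrier G. norm (\<alpha> g (r h) - r (g \<otimes>\<^bsub>G\<^esub> h)) < \<epsilon>) \<and>
             (\<forall>a\<in>F. \<forall>g\<in>carrier G. norm (r g * a - a * r g) < \<epsilon>) \<and>
             (\<forall>a\<in>F. norm ((\<Sum>g\<in>carrier G. r g) * a - a) < \<epsilon>)))"

text \<open>The crossed product by a finite group: functions G \<rightarrow> A (zero off the carrier),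
with twisted convolution and the C*-norm from the left regular representation on the
Hilbert A-module l^2(G,A) (for finite G, reduced = full crossed product).\<close>

definition cp_carrier :: "('g, 'm) monoid_scheme \<Rightarrow> ('g \<Rightarrow> 'a::zero) set" where
  "cp_carrier G = {f. \<forall>g. g \<notin> carrier G \<longrightarrow> f g = 0}"

definition cp_scale :: "(complex \<Rightarrow> 'a \<Rightarrow> 'a) \<Rightarrow> complex \<Rightarrow> ('g \<Rightarrow> 'a) \<Rightarrow> 'g \<Rightarrow> 'a" where
  "cp_scale scC c f = (\<lambda>g. scC c (f g))"

definition cp_mult ::
  "('g, 'm) monoid_scheme \<Rightarrow> ('g \<Rightarrow> 'a \<Rightarrow> 'a::{comm_monoid_add,times}) \<Rightarrow> ('g \<Rightarrow> 'a) \<Rightarrow> ('g \<Rightarrow> 'a) \<Rightarrow> 'g \<Rightarrow> 'a" where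
  "cp_mult G \<alpha> f k = (\<lambda>g. if g \<in> carrier G then
       (\<Sum>h\<in>carrier G. f h * \<alpha> h (k (inv\<^bsub>G\<^esub> h \<otimes>\<^bsub>G\<^esub> g))) else 0)"

definition hm_inner :: "('g, 'm) monoid_scheme \<Rightarrow> ('a \<Rightarrow> 'a) \<Rightarrow> ('g \<Rightarrow> 'a) \<Rightarrow> ('g \<Rightarrow> 'a) \<Rightarrow> 'a::{comm_monoid_add,times}" where
  "hm_inner G st \<xi> \<eta> = (\<Sum>g\<in>carrier G. st (\<xi> g) * \<eta> g)"

definition reg_rep ::
  "('g, 'm) monoid_scheme \<Rightarrow> ('g \<Rightarrow> 'a \<Rightarrow> 'a::{comm_monoid_add,times}) \<Rightarrow> ('g \<Rightarrow> 'a) \<Rightarrow> ('g \<Rightarrow> 'a) \<Rightarrow> 'g \<Rightarrow> 'a" where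
  "reg_rep G \<alpha> f \<eta> = (\<lambda>g. \<Sum>h\<in>carrier G. \<alpha> (inv\<^bsub>G\<^esub> g) (f h) * \<eta> (inv\<^bsub>G\<^esub> h \<otimes>\<^bsub>G\<^esub> g))"

definition cp_norm ::
  "('g, 'm) monoid_scheme \<Rightarrow> ('a \<Rightarrow> 'a) \<Rightarrow> ('g \<Rightarrow> 'a \<Rightarrow> 'a::real_normed_algebra) \<Rightarrow> ('g \<Rightarrow> 'a) \<Rightarrow> real" where
  "cp_norm G st \<alpha> f = Sup {norm (hm_inner G st \<xi> (reg_rep G \<alpha> f \<eta>)) | \<xi> \<eta>.
       norm (hm_inner G st \<xi> \<xi>) \<le> 1 \<and> norm (hm_inner G st \<eta> \<eta>) \<le> 1}"

end

theory Submission
  imports Defs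
begin

text \<open>
  Let \<open>I\<close> be a nonzero closed ideal of the crossed product and \<open>f \<in> I\<close>. If \<open>(r\<^sub>g)\<close> is a Rokhlin family,
  then \<open>\<Sum>g. r\<^sub>g f r\<^sub>g\<close> lies in \<open>I\<close> and is close to the coefficient \<open>f(1)\<close>, so \<open>I \<inter> A\<close> contains the
  coefficient at 1 of every element of \<open>I\<close> and hence is nonzero. As \<open>A\<close> is just-infinite, \<open>I \<inter> A\<close> has
  finite codimension in \<open>A\<close>; since \<open>I\<close> contains all functions with values in \<open>I \<inter> A\<close>, it has finite
  codimension as well.

  Comparing the norm of the crossed product with the coefficientwise norm requires that
  \<open>\<parallel>a\<^sub>j\<parallel>\<^sup>2 \<le> \<parallel>\<Sum>i. a\<^sub>i\<^sup>* a\<^sub>i\<parallel>\<close> and that *-automorphisms are contractive. Both are derived without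
  spectral theory: call a self-adjoint operator \<open>S\<close> on \<open>A\<close> positive if \<open>\<parallel>1 - t S\<parallel> \<le> 1 + o(t)\<close> as
  \<open>t \<rightarrow> 0\<close>. This notion is additive, squares are positive, and a fixed-point argument shows that
  \<open>S + \<epsilon>\<close> is a square whenever \<open>S\<close> is positive.
\<close>

section \<open>Bounded operators as an algebra with unit\<close>

text \<open>A copy of the bounded operators on one space, made so that composition becomes the class
  product \<open>*\<close>. It supplies a unit even when the C*-algebra itself has none.\<close>

typedef (overloaded) 'a endo = "UNIV :: ('a::real_normed_vector \<Rightarrow>\<^sub>L 'a) set"
  morphisms endo_blinfun Endo ..

setup_lifting type_definition_endo

instantiation endo :: (real_normed_vector) real_normed_vector
begin

lift_definition norm_endo :: "'a endo \<Rightarrow> real" is norm .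
lift_definition minus_endo :: "'a endo \<Rightarrow> 'a endo \<Rightarrow> 'a endo" is minus .
lift_definition uminus_endo :: "'a endo \<Rightarrow> 'a endo" is uminus .
lift_definition zero_endo :: "'a endo" is 0 .
lift_definition plus_endo :: "'a endo \<Rightarrow> 'a endo \<Rightarrow> 'a endo" is plus .
lift_definition scaleR_endo :: "real \<Rightarrow> 'a endo \<Rightarrow> 'a endo" is scaleR .
definition sgn_endo :: "'a endo \<Rightarrow> 'a endo"
  where "sgn_endo x = scaleR (inverse (norm x)) x"
definition dist_endo :: "'a endo \<Rightarrow> 'a endo \<Rightarrow> real"
  where "dist_endo x y = norm (x - y)"
definition uniformity_endo :: "('a endo \<times> 'a endo) filter"
  where "uniformity_endo = (INF e\<in>{0 <..}. principal {(x, y). dist x y < e})"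
definition open_endo :: "'a endo set \<Rightarrow> bool"
  where "open_endo S = (\<forall>x\<in>S. \<forall>\<^sub>F (x', y) in uniformity. x' = x \<longrightarrow> y \<in> S)"

instance
  apply standard
  unfolding dist_endo_def open_endo_def sgn_endo_def uniformity_endo_def
  apply (rule refl | (transfer, force simp: norm_triangle_ineq algebra_simps))+
  done

end

instantiation endo :: (real_normed_vector) "{real_normed_algebra, monoid_mult}"
begin

lift_definition one_endo :: "'a endo" is id_blinfun .
lift_definition times_endo :: "'a endo \<Rightarrow> 'a endo \<Rightarrow> 'a endo" is blinfun_compose .

instance
  by standard (transfer, force intro: blinfun_eqI norm_blinfun_compose
      simp: blinfun.bilinear_simps algebra_simps)+

end

instance endo :: (banach) banach
proof
  fix X :: "nat \<Rightarrow> 'a endo"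
  assume X: "Cauchy X"
  have nrm: "norm (endo_blinfun x - endo_blinfun y) = norm (x - y)" for x y :: "'a endo"
    by transfer simp
  have "Cauchy (\<lambda>n. endo_blinfun (X n))"
    using X unfolding Cauchy_def dist_norm nrm .
  then obtain L where "(\<lambda>n. endo_blinfun (X n)) \<longlonglongrightarrow> L"
    using Cauchy_convergent convergent_def by blast
  then have "(\<lambda>n. endo_blinfun (X n)) \<longlonglongrightarrow> endo_blinfun (Endo L)"
    by (simp add: Endo_inverse)
  then have "X \<longlonglongrightarrow> Endo L"
    unfolding lim_sequentially dist_norm nrm .
  then show "convergent X"
    unfolding convergent_def by blast
qed

definition endo_apply :: "'a::real_normed_vector endo \<Rightarrow> 'a \<Rightarrow> 'a"
  where "endo_apply S = blinfun_apply (endo_blinfun S)"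

lemma endo_apply_simps [simp]:
  "endo_apply 0 x = 0" "endo_apply 1 x = x"
  "endo_apply (S + T) x = endo_apply S x + endo_apply T x"
  "endo_apply (S - T) x = endo_apply S x - endo_apply T x"
  "endo_apply (- S) x = - endo_apply S x"
  "endo_apply (r *\<^sub>R S) x = r *\<^sub>R endo_apply S x"
  "endo_apply (S * T) x = endo_apply S (endo_apply T x)"
  unfolding endo_apply_def by (transfer, simp add: blinfun.bilinear_simps)+

lemma endo_eqI: "(\<And>x. endo_apply S x = endo_apply T x) \<Longrightarrow> S = T"
  unfolding endo_apply_def by (transfer, rule blinfun_eqI)

lemma norm_endo_apply_le: "norm (endo_apply S x) \<le> norm S * norm x"
  unfolding endo_apply_def by (transfer, rule norm_blinfun)

lemma norm_endo_bound:
  "0 \<le> b \<Longrightarrow> (\<And>x. norm (endo_apply S x) \<le> b * norm x) \<Longrightarrow> norm S \<le> b"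
  unfolding endo_apply_def by (transfer, rule norm_blinfun_bound)

lemma bounded_linear_endo_apply_left: "bounded_linear (\<lambda>S. endo_apply S x)"
  by (rule bounded_linear_intro[where K = "norm x"])
     (simp_all add: norm_endo_apply_le)

definition endo_of :: "('a \<Rightarrow> 'a) \<Rightarrow> 'a::real_normed_vector endo"
  where "endo_of f = Endo (Blinfun f)"

lemma endo_apply_endo_of: "bounded_linear f \<Longrightarrow> endo_apply (endo_of f) = f"
  by (simp add: endo_apply_def endo_of_def Endo_inverse bounded_linear_Blinfun_apply)

section \<open>Square roots in Banach algebras\<close>

text \<open>In an algebra with unit the conclusion says \<open>(1 - r)\<^sup>2 = 1 - y\<close>.\<close>

lemma banach_algebra_sqrt:
  fixes y :: "'b::{real_normed_algebra,banach}"
  assumes q: "norm y \<le> q" "q < 1"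
    and cl: "closed C" and zero: "0 \<in> C"
    and step: "\<And>r. r \<in> C \<Longrightarrow> (1/2) *\<^sub>R (y + r * r) \<in> C"
  obtains r where "norm r \<le> q" "r \<in> C" "2 *\<^sub>R r - r * r = y"
proof -
  let ?S = "C \<inter> cball 0 q"
  let ?f = "\<lambda>r. (1/2) *\<^sub>R (y + r * r)"
  have q0: "0 \<le> q" using q(1) norm_ge_zero order_trans by blast
  \<comment> \<open>The equation to solve is \<open>r = (y + r * r) / 2\<close>. Its right-hand side
    is a contraction on the ball of radius \<open>q < 1\<close>, and \<open>C\<close> passes closed
    properties of the iterates on to the root.\<close>
  have "\<exists>!r\<in>?S. ?f r = r"
  proof (rule Banach_fix)
    show "complete ?S" using cl by (simp add: complete_eq_closed closed_Int)
    show "?S \<noteq> {}" using zero q0 by auto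
    show "0 \<le> q" "q < 1" using q0 q by auto
    show "?f ` ?S \<subseteq> ?S"
    proof (intro image_subsetI IntI)
      fix r assume r: "r \<in> ?S"
      show "?f r \<in> C" using r step by auto
      have "norm (r * r) \<le> q * q"
        using r q0 by (intro order_trans[OF norm_mult_ineq] mult_mono) auto
      also have "\<dots> \<le> q" using q0 q(2) by (simp add: mult_left_le)
      finally have "norm (y + r * r) \<le> q + q"
        using q(1) norm_triangle_mono by blast
      then show "?f r \<in> cball 0 q" by simp
    qed
    fix r s assume rs: "r \<in> ?S" "s \<in> ?S"
    have "?f r - ?f s = (1/2) *\<^sub>R (r * (r - s) + (r - s) * s)"
      by (simp add: algebra_simps)
    then have "dist (?f r) (?f s) = (1/2) * norm (r * (r - s) + (r - s) * s)"
      by (simp add: dist_norm)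
    also have "\<dots> \<le> (1/2) * (norm r * norm (r - s) + norm (r - s) * norm s)"
      by (intro mult_left_mono norm_triangle_mono norm_mult_ineq) auto
    also have "\<dots> \<le> (1/2) * (q * norm (r - s) + norm (r - s) * q)"
      using rs by (intro mult_left_mono add_mono mult_right_mono mult_left_mono) auto
    finally show "dist (?f r) (?f s) \<le> q * dist r s"
      by (simp add: dist_norm algebra_simps)
  qed
  then obtain r where r: "r \<in> C" "norm r \<le> q" "?f r = r" by auto
  have "2 *\<^sub>R r = 2 *\<^sub>R ?f r" using r(3) by simp
  then have "2 *\<^sub>R r = y + r * r" by simp
  then show thesis using that r by simp
qed

lemma closed_bicommutant:
  "closed {r :: 'b::real_normed_algebra. \<forall>z. z * y = y * z \<longrightarrow> z * r = r * z}"
proof -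
  have "{r. \<forall>z. z * y = y * z \<longrightarrow> z * r = r * z} = (\<Inter>z\<in>{z. z * y = y * z}. {r. z * r = r * z})"
    by auto
  then show ?thesis
    by (auto intro!: closed_INT closed_Collect_eq continuous_intros)
qed

section \<open>Positivity without spectral theory\<close>

text \<open>Bernoulli's inequality is applied to \<open>sqrt z = 1 + d\<close>: with
  \<open>n = 2 ^ m\<close>, squaring gives \<open>z ^ n \<ge> (1 + n * d)\<^sup>2\<close>, which is
  quadratic in \<open>n\<close> and overtakes every linear bound.\<close>

lemma le_one_if_powers_grow_linearly:
  fixes z C :: real
  assumes z: "0 \<le> z" and bound: "\<And>m. z ^ (2 ^ m) \<le> 1 + C * 2 ^ m"
  shows "z \<le> 1"
proof (rule ccontr)
  assume "\<not> z \<le> 1"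
  then have "1 < sqrt z" by simp
  then obtain d where d: "sqrt z = 1 + d" "0 < d"
    by (metis add_diff_cancel_left' diff_add_cancel add.commute diff_gt_0_iff_gt)
  have key: "2 ^ m * (d * d) \<le> C" for m
  proof -
    let ?n = "2 ^ m :: nat"
    have "1 + real ?n * d \<le> (1 + d) ^ ?n"
      using d(2) by (intro Bernoulli_inequality) auto
    then have "(1 + real ?n * d)\<^sup>2 \<le> ((1 + d) ^ ?n)\<^sup>2"
      using d(2) by (intro power_mono) auto
    also have "\<dots> = ((1 + d)\<^sup>2) ^ ?n"
      by (simp add: power_mult[symmetric] mult.commute)
    also have "\<dots> = z ^ ?n"
      using d(1) z by (metis real_sqrt_pow2)
    also have "\<dots> \<le> 1 + C * 2 ^ m" by (rule bound)
    finally have "1 + 2 * (real ?n * d) + (real ?n * d)\<^sup>2 \<le> 1 + C * 2 ^ m"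
      by (simp add: power2_sum algebra_simps)
    moreover have "0 \<le> real ?n * d" using d(2) by simp
    ultimately have "(real ?n * d)\<^sup>2 \<le> C * 2 ^ m" by linarith
    then have "(2 ^ m * (d * d)) * 2 ^ m \<le> C * 2 ^ m"
      by (simp only: power2_eq_square of_nat_power of_nat_numeral mult.assoc mult.left_commute mult.commute)
    then show ?thesis by (rule mult_right_le_imp_le) simp
  qed
  obtain m where "C / (d * d) < 2 ^ m"
    using real_arch_pow[of 2 "C / (d * d)"] by auto
  then have "C < 2 ^ m * (d * d)"
    using d(2) by (simp add: divide_less_eq)
  with key[of m] show False by simp
qed

text \<open>An algebra of operators in which \<open>adj S S'\<close> says that \<open>S'\<close> is an adjoint of \<open>S\<close>; not every
  element needs to have one. \<open>J\<close> plays the role of the imaginary unit.\<close>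

locale adjoint_algebra =
  fixes adj :: "'b::{real_normed_algebra,monoid_mult,banach} \<Rightarrow> 'b \<Rightarrow> bool"
    and J :: 'b
  assumes adj_sym: "adj S S' \<Longrightarrow> adj S' S"
    and adj_one: "adj 1 1"
    and adj_add: "adj S S' \<Longrightarrow> adj T T' \<Longrightarrow> adj (S + T) (S' + T')"
    and adj_scaleR: "adj S S' \<Longrightarrow> adj (c *\<^sub>R S) (c *\<^sub>R S')"
    and adj_mult: "adj S S' \<Longrightarrow> adj T T' \<Longrightarrow> adj (S * T) (T' * S')"
    and closed_sa: "closed {S. adj S S}"
    and cstar_ineq: "adj S S' \<Longrightarrow> (norm S)\<^sup>2 \<le> norm (S' * S)"
    and adj_J: "adj J (- J)"
    and J_J: "J * J = - 1"
    and J_commute: "adj S S' \<Longrightarrow> J * S = S * J"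
    and norm_one_le: "norm (1::'b) \<le> 1"
begin

lemma adj_minus: "adj S S' \<Longrightarrow> adj (- S) (- S')"
  using adj_scaleR[of S S' "-1"] by simp

lemma adj_diff: "adj S S' \<Longrightarrow> adj T T' \<Longrightarrow> adj (S - T) (S' - T')"
  using adj_add[of S S' "- T" "- T'"] adj_minus[of T T'] by simp

lemma adj_zero: "adj 0 0"
  using adj_scaleR[OF adj_one, of 0] by simp

lemma J_mult_square:
  assumes "J * x = x * J"
  shows "(J * x) * (J * x) = - (x * x)"
proof -
  have "(J * x) * (J * x) = x * (J * J) * x"
    by (subst assms) (simp only: mult.assoc)
  then show ?thesis by (simp add: J_J)
qed

lemma sa_power: "adj S S \<Longrightarrow> adj (S ^ n) (S ^ n)"
  by (induction n) (auto simp: adj_one power_commutes dest: adj_mult[of S S])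

lemma norm_power_bound:
  fixes U :: 'b
  shows "norm U \<le> q \<Longrightarrow> norm (U ^ n) \<le> q ^ n"
proof (induction n)
  case (Suc n)
  have "norm (U ^ Suc n) \<le> norm U * norm (U ^ n)" by (simp only: power_Suc norm_mult_ineq)
  also have "\<dots> \<le> q * q ^ n"
    using Suc by (intro mult_mono order_trans[OF norm_ge_zero, of U q]) auto
  finally show ?case by simp
qed (simp add: norm_one_le)

text \<open>Iterated squaring with the C*-inequality for self-adjoint elements; this is why growth
  of powers is tested along exponents \<open>2 ^ m\<close> only.\<close>

lemma sa_norm_power: "adj U U \<Longrightarrow> norm U ^ (2 ^ m) \<le> norm (U ^ (2 ^ m))"
proof (induction m)
  case (Suc m)
  have "norm U ^ (2 ^ Suc m) = (norm U ^ (2 ^ m))\<^sup>2"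
    by (simp add: power_mult[symmetric] mult.commute)
  also have "\<dots> \<le> (norm (U ^ (2 ^ m)))\<^sup>2" using Suc by (intro power_mono) auto
  also have "\<dots> \<le> norm (U ^ (2 ^ m) * U ^ (2 ^ m))"
    using Suc.prems by (intro cstar_ineq sa_power)
  also have "\<dots> = norm (U ^ (2 ^ Suc m))" by (simp add: power_add[symmetric] mult_2)
  finally show ?case .
qed simp

section \<open>The cone of positive elements\<close>

text \<open>A negative spectral value \<open>- c\<close> would force
  \<open>norm (1 - t *\<^sub>R S) \<ge> 1 + t * c\<close>, so the condition excludes a negative part
  in terms of norms alone.\<close>

definition pos :: "'b \<Rightarrow> bool"
  where "pos S \<longleftrightarrow> adj S S \<and> (\<forall>\<epsilon>>0. \<exists>t>0. norm (1 - t *\<^sub>R S) \<le> 1 + t * \<epsilon>)"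

lemma pos_sa: "pos S \<Longrightarrow> adj S S"
  by (simp add: pos_def)

lemma pos_small_parameter:
  assumes "pos S" "0 < \<epsilon>" "0 < \<delta>"
  obtains t where "0 < t" "t \<le> \<delta>" "norm (1 - t *\<^sub>R S) \<le> 1 + t * \<epsilon>"
proof -
  obtain s where s: "0 < s" "norm (1 - s *\<^sub>R S) \<le> 1 + s * \<epsilon>"
    using assms unfolding pos_def by blast
  define t where "t = min s \<delta>"
  have t: "0 < t" "t \<le> \<delta>" "t \<le> s" using s assms by (auto simp: t_def)
  have "1 - t *\<^sub>R S = (1 - t / s) *\<^sub>R 1 + (t / s) *\<^sub>R (1 - s *\<^sub>R S)"
    using s(1) by (simp add: algebra_simps)
  then have "norm (1 - t *\<^sub>R S) \<le> norm ((1 - t / s) *\<^sub>R (1::'b)) + norm ((t / s) *\<^sub>R (1 - s *\<^sub>R S))"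
    by (metis norm_triangle_ineq)
  also have "\<dots> \<le> (1 - t / s) * 1 + (t / s) * (1 + s * \<epsilon>)"
    using s t norm_one_le unfolding norm_scaleR
    by (intro add_mono mult_mono) (auto simp: divide_simps)
  also have "\<dots> = 1 + t * \<epsilon>" using s(1) by (simp add: field_simps)
  finally show thesis using that t by blast
qed

lemma pos_if_norm_one_minus_le: "adj S S \<Longrightarrow> norm (1 - S) \<le> 1 \<Longrightarrow> pos S"
  unfolding pos_def by (auto intro!: exI[of _ 1] elim: order_trans)

lemma pos_approx:
  assumes S: "adj S S" and P: "\<And>\<delta>. 0 < \<delta> \<Longrightarrow> \<exists>P. pos P \<and> norm (S - P) \<le> \<delta>"
  shows "pos S"
  unfolding pos_def
proof (intro conjI S allI impI)
  fix \<epsilon> :: real assume e: "0 < \<epsilon>"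
  then obtain P where P: "pos P" "norm (S - P) \<le> \<epsilon> / 2" using P[of "\<epsilon> / 2"] by auto
  obtain t where t: "0 < t" "norm (1 - t *\<^sub>R P) \<le> 1 + t * (\<epsilon> / 2)"
    using P(1) e unfolding pos_def by (meson half_gt_zero)
  have "1 - t *\<^sub>R S = (1 - t *\<^sub>R P) - t *\<^sub>R (S - P)" by (simp add: algebra_simps)
  then have "norm (1 - t *\<^sub>R S) \<le> norm (1 - t *\<^sub>R P) + norm (t *\<^sub>R (S - P))"
    by (metis norm_triangle_ineq4)
  also have "\<dots> \<le> (1 + t * (\<epsilon> / 2)) + t * (\<epsilon> / 2)"
    using t P by (intro add_mono) auto
  finally show "\<exists>t>0. norm (1 - t *\<^sub>R S) \<le> 1 + t * \<epsilon>" using t(1) by (auto simp: algebra_simps)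
qed

lemma pos_add:
  assumes "pos S" "pos T"
  shows "pos (S + T)"
  unfolding pos_def
proof (intro conjI allI impI)
  show "adj (S + T) (S + T)" using assms by (intro adj_add pos_sa)
  fix \<epsilon> :: real assume e: "0 < \<epsilon>"
  obtain s where s: "0 < s" "norm (1 - s *\<^sub>R S) \<le> 1 + s * (\<epsilon> / 2)"
    using pos_small_parameter[OF assms(1), of "\<epsilon> / 2" 1] e by auto
  obtain t where t: "0 < t" "norm (1 - t *\<^sub>R T) \<le> 1 + t * (\<epsilon> / 2)"
    using pos_small_parameter[OF assms(2), of "\<epsilon> / 2" 1] e by auto
  \<comment> \<open>With this \<open>u\<close> the weights \<open>u / s\<close> and
    \<open>u / t\<close> add up to 1, so \<open>1 - u *\<^sub>R (S + T)\<close> is a convex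
    combination of \<open>1 - s *\<^sub>R S\<close> and \<open>1 - t *\<^sub>R T\<close>.\<close>
  define u where "u = s * t / (s + t)"
  have u: "0 < u" using s t by (simp add: u_def)
  have us: "u / s = t / (s + t)" "u / t = s / (s + t)" "t / (s + t) + s / (s + t) = 1"
    using s t by (auto simp: u_def divide_simps)
  have "1 - u *\<^sub>R (S + T) = (u / s + u / t) *\<^sub>R 1 - u *\<^sub>R (S + T)" using us by simp
  also have "\<dots> = (u / s) *\<^sub>R (1 - s *\<^sub>R S) + (u / t) *\<^sub>R (1 - t *\<^sub>R T)"
    using s t by (simp add: algebra_simps)
  finally have "norm (1 - u *\<^sub>R (S + T))
      \<le> norm ((u / s) *\<^sub>R (1 - s *\<^sub>R S)) + norm ((u / t) *\<^sub>R (1 - t *\<^sub>R T))"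
    by (metis norm_triangle_ineq)
  also have "\<dots> \<le> (u / s) * (1 + s * (\<epsilon> / 2)) + (u / t) * (1 + t * (\<epsilon> / 2))"
    using s t u unfolding norm_scaleR by (intro add_mono mult_mono) auto
  also have "\<dots> = (u / s + u / t) + u * \<epsilon>" using s t by (simp add: field_simps)
  finally show "\<exists>t>0. norm (1 - t *\<^sub>R (S + T)) \<le> 1 + t * \<epsilon>"
    using us u by (intro exI[of _ u]) simp
qed

lemma pos_zero: "pos 0"
  unfolding pos_def using adj_zero norm_one_le
  by (auto intro!: exI[of _ "1::real"] elim: order_trans)

lemma pos_sum: "(\<And>i. i \<in> I \<Longrightarrow> pos (f i)) \<Longrightarrow> pos (sum f I)"
  by (induction I rule: infinite_finite_induct) (auto simp: pos_zero pos_add)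

lemma pos_scaleR:
  assumes "pos S" "0 \<le> c"
  shows "pos (c *\<^sub>R S)"
proof (cases "c = 0")
  case False
  then have c: "0 < c" using assms by simp
  show ?thesis unfolding pos_def
  proof (intro conjI allI impI)
    show "adj (c *\<^sub>R S) (c *\<^sub>R S)" using assms by (intro adj_scaleR pos_sa)
    fix \<epsilon> :: real assume "0 < \<epsilon>"
    then obtain t where "0 < t" "norm (1 - t *\<^sub>R S) \<le> 1 + t * (\<epsilon> / c)"
      using assms(1) c unfolding pos_def by (meson divide_pos_pos)
    then show "\<exists>t>0. norm (1 - t *\<^sub>R c *\<^sub>R S) \<le> 1 + t * \<epsilon>"
      using c by (intro exI[of _ "t / c"]) auto
  qed
qed (simp add: pos_zero)

lemma pos_one_minus:
  assumes "adj S S" "norm S \<le> c"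
  shows "pos (c *\<^sub>R 1 - S)"
proof (cases "c = 0")
  case False
  then have c: "0 < c" using assms(2) by (smt (verit) norm_ge_zero)
  have "norm ((1 / c) *\<^sub>R S) \<le> 1" using assms c by simp
  then have "pos (1 - (1 / c) *\<^sub>R S)"
    using assms by (intro pos_if_norm_one_minus_le adj_diff adj_one adj_scaleR) simp_all
  from pos_scaleR[OF this, of c] c show ?thesis by (simp add: algebra_simps)
qed (use assms pos_zero in auto)

text \<open>\<open>u = 1 - t h\<^sup>2 + \<surd>(2t) i h\<close> approximates \<open>exp (\<surd>(2t) i h)\<close>, so it is nearly unitary.\<close>

lemma norm_one_minus_square_le:
  assumes h: "adj h h" and t: "0 \<le> t"
  shows "norm (1 - t *\<^sub>R (h * h)) \<le> 1 + t\<^sup>2 * norm h ^ 4"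
proof -
  define s where "s = sqrt (2 * t)"
  have ss: "s * s = 2 * t" using t by (simp add: s_def)
  define g where "g = 1 - t *\<^sub>R (h * h)"
  define k where "k = s *\<^sub>R (J * h)"
  have Jh: "J * h = h * J" using h by (rule J_commute)
  have g: "adj g g" unfolding g_def using h by (intro adj_diff adj_one adj_scaleR adj_mult)
  have "adj (J * h) (h * (- J))" using h by (intro adj_mult adj_J)
  then have k: "adj k (- k)" using adj_scaleR[of "J * h" "- (J * h)" s] Jh by (simp add: k_def)
  have u: "adj (g + k) (g - k)" using adj_add[OF g k] by simp
  have JhJh: "(J * h) * (J * h) = - (h * h)" by (rule J_mult_square[OF Jh])
  have kk: "k * k = - ((2 * t) *\<^sub>R (h * h))"
    using JhJh ss by (simp add: k_def)
  have "(h * h) * (J * h) = h * (h * J) * h" by (simp only: mult.assoc)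
  also have "\<dots> = h * (J * h) * h" by (simp only: Jh)
  also have "\<dots> = (h * J) * (h * h)" by (simp only: mult.assoc)
  finally have hk: "(h * h) * (J * h) = (J * h) * (h * h)" by (simp only: Jh)
  have hgk: "g * k = k * g"
    unfolding g_def k_def
    by (simp only: left_diff_distrib right_diff_distrib mult_1_left mult_1_right
        mult_scaleR_left mult_scaleR_right scaleR_diff_right scaleR_scaleR hk mult.commute)
  \<comment> \<open>The terms of first order in \<open>t\<close> cancel between \<open>g * g\<close>
    and \<open>k * k\<close>; this dictates the factor \<open>sqrt (2 * t)\<close> and leaves an
    error of order \<open>t\<^sup>2\<close>.\<close>
  have gg: "g * g - k * k = 1 + t\<^sup>2 *\<^sub>R ((h * h) * (h * h))"
  proof -
    have "g * g = 1 - t *\<^sub>R (h * h) - t *\<^sub>R (h * h) + (t * t) *\<^sub>R ((h * h) * (h * h))"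
      unfolding g_def
      by (simp only: left_diff_distrib right_diff_distrib mult_1_left mult_1_right
          mult_scaleR_left mult_scaleR_right scaleR_diff_right scaleR_scaleR) simp
    then show ?thesis unfolding kk power2_eq_square mult_2 scaleR_add_left by simp
  qed
  have "norm ((h * h) * (h * h)) \<le> (norm h * norm h) * (norm h * norm h)"
    by (intro order_trans[OF norm_mult_ineq] mult_mono) (auto simp: norm_mult_ineq)
  then have "t\<^sup>2 * norm ((h * h) * (h * h)) \<le> t\<^sup>2 * norm h ^ 4"
    by (intro mult_left_mono) (simp_all add: power4_eq_xxxx mult.assoc)
  then have bound: "norm (g * g - k * k) \<le> 1 + t\<^sup>2 * norm h ^ 4"
    unfolding gg using norm_one_le by (intro norm_triangle_mono) auto
  let ?c = "1 + t\<^sup>2 * norm h ^ 4"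
  have c1: "1 \<le> ?c" by simp
  have sq: "n \<le> ?c" if "n\<^sup>2 \<le> ?c" "0 \<le> n" for n :: real
  proof (rule power2_le_imp_le)
    have "?c \<le> ?c\<^sup>2" using c1 by (rule self_le_power) simp
    with that(1) show "n\<^sup>2 \<le> ?c\<^sup>2" by (rule order_trans)
  qed (use c1 in simp)
  have "(g - k) * (g + k) = g * g - k * k" "(g + k) * (g - k) = g * g - k * k"
    by (simp_all only: left_diff_distrib right_diff_distrib distrib_left distrib_right hgk) simp_all
  then have "(norm (g + k))\<^sup>2 \<le> ?c" "(norm (g - k))\<^sup>2 \<le> ?c"
    using cstar_ineq[OF u] cstar_ineq[OF adj_sym[OF u]] bound by auto
  then have "norm (g + k) \<le> ?c" "norm (g - k) \<le> ?c"
    by (simp_all only: sq norm_ge_zero)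
  then have "norm ((g + k) + (g - k)) \<le> ?c + ?c" by (rule norm_triangle_mono)
  moreover have "(g + k) + (g - k) = 2 *\<^sub>R g" by (simp add: scaleR_2)
  ultimately show ?thesis by (simp add: g_def)
qed

lemma pos_square:
  assumes h: "adj h h"
  shows "pos (h * h)"
  unfolding pos_def
proof (intro conjI allI impI)
  show "adj (h * h) (h * h)" using h by (intro adj_mult)
  fix \<epsilon> :: real assume e: "0 < \<epsilon>"
  define t where "t = \<epsilon> / (norm h ^ 4 + 1)"
  have p: "0 < norm h ^ 4 + 1" by (simp add: add_nonneg_pos)
  have t: "0 < t" using e p by (simp add: t_def)
  have "t * norm h ^ 4 \<le> t * (norm h ^ 4 + 1)" using t by (intro mult_left_mono) auto
  also have "\<dots> = \<epsilon>" using p by (simp add: t_def)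
  finally have "t * (t * norm h ^ 4) \<le> t * \<epsilon>" using t by (intro mult_left_mono) auto
  moreover have "norm (1 - t *\<^sub>R (h * h)) \<le> 1 + t * (t * norm h ^ 4)"
    using norm_one_minus_square_le[OF h, of t] t by (simp add: power2_eq_square mult.assoc)
  ultimately have "norm (1 - t *\<^sub>R (h * h)) \<le> 1 + t * \<epsilon>" by linarith
  then show "\<exists>t>0. norm (1 - t *\<^sub>R (h * h)) \<le> 1 + t * \<epsilon>" using t by blast
qed

section \<open>Square roots, commuting products and norm bounds from the order\<close>

text \<open>Scaling by \<open>c\<close> brings the norm of \<open>y\<close> below 1, strictly so
  thanks to the shift by \<open>\<epsilon>\<close>. Then \<open>(1 - r)\<^sup>2 = 1 - y\<close> is
  \<open>s * c\<close> times \<open>S + \<epsilon>\<close>, and \<open>1 - r\<close> only needs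
  rescaling.\<close>

lemma pos_sqrt:
  assumes S: "pos S" and e: "0 < \<epsilon>"
  obtains H where "adj H H" "H * H = S + \<epsilon> *\<^sub>R 1" "\<And>z. z * S = S * z \<Longrightarrow> z * H = H * z"
proof -
  obtain s where s: "0 < s" "norm (1 - s *\<^sub>R S) \<le> 1 + s * (\<epsilon> / 2)"
    using S e unfolding pos_def by (meson half_gt_zero)
  define c where "c = 1 / (1 + s * \<epsilon>)"
  have se: "0 < s * \<epsilon>" using s e by simp
  have c: "0 < c" "c * (1 + s * \<epsilon>) = 1" using se by (auto simp: c_def)
  define y where "y = c *\<^sub>R (1 - s *\<^sub>R S)"
  \<comment> \<open>Keeping the fixed point in the bicommutant of \<open>y\<close> makes the root
    commute with whatever commutes with \<open>S\<close>.\<close>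
  define C where "C = {r. adj r r} \<inter> {r. \<forall>z. z * y = y * z \<longrightarrow> z * r = r * z}"
  have CD: "adj r r" "z * y = y * z \<Longrightarrow> z * r = r * z" if "r \<in> C" for r z
    using that unfolding C_def by blast+
  have ysa: "adj y y" unfolding y_def using S by (intro adj_scaleR adj_diff adj_one pos_sa)
  obtain r where r: "r \<in> C" "2 *\<^sub>R r - r * r = y"
  proof (rule banach_algebra_sqrt)
    show "norm y \<le> c * (1 + s * (\<epsilon> / 2))"
      using s c by (simp add: y_def)
    have "c * (1 + s * (\<epsilon> / 2)) < c * (1 + s * \<epsilon>)"
      using c(1) se by (intro mult_strict_left_mono) linarith+
    then show "c * (1 + s * (\<epsilon> / 2)) < 1" using c by simp
    show "closed C" unfolding C_def using closed_sa closed_bicommutant by (intro closed_Int)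
    show "0 \<in> C" using adj_zero unfolding C_def by simp
    fix r assume r: "r \<in> C"
    have "z * ((1/2) *\<^sub>R (y + r * r)) = (1/2) *\<^sub>R (y + r * r) * z" if z: "z * y = y * z" for z
    proof -
      have zr: "z * r = r * z" using r z by (rule CD(2))
      have "z * (r * r) = (z * r) * r" by (simp only: mult.assoc)
      also have "\<dots> = r * (z * r)" by (simp only: zr mult.assoc)
      also have "\<dots> = (r * r) * z" by (simp only: zr mult.assoc)
      finally show ?thesis
        by (simp only: distrib_left distrib_right mult_scaleR_left mult_scaleR_right z)
    qed
    moreover have "adj ((1/2) *\<^sub>R (y + r * r)) ((1/2) *\<^sub>R (y + r * r))"
      by (intro adj_scaleR adj_add adj_mult ysa CD(1)[OF r])
    ultimately show "(1/2) *\<^sub>R (y + r * r) \<in> C" unfolding C_def by blast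
  qed
  define k where "k = 1 / (s * c)"
  have k: "0 < k" using s c by (simp add: k_def)
  define H where "H = sqrt k *\<^sub>R (1 - r)"
  show thesis
  proof
    show "adj H H" unfolding H_def by (intro adj_scaleR adj_diff adj_one CD(1)[OF r(1)])
    have "(1 - r) * (1 - r) = 1 - (2 *\<^sub>R r - r * r)" by (simp add: algebra_simps scaleR_2)
    also have "\<dots> = (c * (1 + s * \<epsilon>)) *\<^sub>R 1 - y" by (simp only: r(2) c(2) scaleR_one)
    also have "\<dots> = (s * c) *\<^sub>R (S + \<epsilon> *\<^sub>R 1)" by (simp add: y_def algebra_simps)
    finally have "H * H = (k * (s * c)) *\<^sub>R (S + \<epsilon> *\<^sub>R 1)" using k by (simp add: H_def)
    then show "H * H = S + \<epsilon> *\<^sub>R 1" using s c by (simp add: k_def)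
    fix z assume z: "z * S = S * z"
    then have "z * y = y * z"
      by (simp only: y_def left_diff_distrib right_diff_distrib mult_scaleR_left mult_scaleR_right
          mult_1_left mult_1_right)
    then have "z * r = r * z" by (rule CD(2)[OF r(1)])
    then show "z * H = H * z"
      by (simp only: H_def left_diff_distrib right_diff_distrib mult_scaleR_left mult_scaleR_right
          mult_1_left mult_1_right)
  qed
qed

lemma pos_sqrt_commuting:
  assumes "pos X" "pos Y" "X * Y = Y * X" "0 < \<epsilon>"
  obtains H K where "adj H H" "adj K K" "H * H = X + \<epsilon> *\<^sub>R 1" "K * K = Y + \<epsilon> *\<^sub>R 1" "H * K = K * H"
proof -
  obtain H where H: "adj H H" "H * H = X + \<epsilon> *\<^sub>R 1" "\<And>z. z * X = X * z \<Longrightarrow> z * H = H * z"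
    using pos_sqrt[OF assms(1,4)] by blast
  obtain K where K: "adj K K" "K * K = Y + \<epsilon> *\<^sub>R 1" "\<And>z. z * Y = Y * z \<Longrightarrow> z * K = K * z"
    using pos_sqrt[OF assms(2,4)] by blast
  have "X * K = K * X" by (rule K(3)[OF assms(3)])
  then have "K * H = H * K" by (intro H(3)) (rule sym)
  then show thesis using that[OF H(1) K(1) H(2) K(2)] by (simp only:)
qed

text \<open>For commuting roots \<open>H\<close> and \<open>K\<close> of
  \<open>X + \<epsilon>\<close> and \<open>Y + \<epsilon>\<close> the product \<open>H * K\<close>
  is self-adjoint, and its square \<open>(X + \<epsilon>) * (Y + \<epsilon>)\<close> tends to
  \<open>X * Y\<close>.\<close>

lemma pos_mult:
  assumes X: "pos X" and Y: "pos Y" and XY: "X * Y = Y * X"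
  shows "pos (X * Y)"
proof (rule pos_approx)
  show "adj (X * Y) (X * Y)" using adj_mult[OF pos_sa[OF X] pos_sa[OF Y]] XY by simp
  fix \<delta> :: real assume d: "0 < \<delta>"
  define m where "m = norm X + norm Y + 1"
  have m: "0 < m" by (simp add: m_def add_nonneg_pos)
  define \<epsilon> where "\<epsilon> = min 1 (\<delta> / m)"
  have e: "0 < \<epsilon>" "\<epsilon> \<le> 1" "\<epsilon> \<le> \<delta> / m" using d m by (auto simp: \<epsilon>_def)
  obtain H K where HK: "adj H H" "adj K K" "H * H = X + \<epsilon> *\<^sub>R 1" "K * K = Y + \<epsilon> *\<^sub>R 1" "H * K = K * H"
    using pos_sqrt_commuting[OF X Y XY e(1)] by blast
  let ?P = "(H * K) * (H * K)"
  have "adj (H * K) (H * K)" using adj_mult[OF HK(1,2)] HK(5) by simp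
  then have P: "pos ?P" by (rule pos_square)
  have "?P = H * (K * H) * K" by (simp only: mult.assoc)
  also have "\<dots> = (H * H) * (K * K)" by (simp only: HK(5)[symmetric] mult.assoc)
  finally have PHK: "?P = (H * H) * (K * K)" .
  have "X * Y - ?P = - (\<epsilon> *\<^sub>R (X + Y + \<epsilon> *\<^sub>R 1))"
    unfolding PHK HK(3,4) by (simp add: algebra_simps)
  then have "norm (X * Y - ?P) = \<epsilon> * norm (X + Y + \<epsilon> *\<^sub>R 1)"
    using e by (simp only: norm_minus_cancel norm_scaleR abs_of_pos)
  also have "\<dots> \<le> \<epsilon> * m"
  proof (rule mult_left_mono)
    show "norm (X + Y + \<epsilon> *\<^sub>R 1) \<le> m"
      unfolding m_def using e norm_one_le
      by (intro norm_triangle_mono order_refl) (auto simp: mult_le_one)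
  qed (use e in simp)
  also have "\<dots> \<le> \<delta>" using e m by (simp add: pos_le_divide_eq)
  finally show "\<exists>P. pos P \<and> norm (X * Y - P) \<le> \<delta>" using P by blast
qed

text \<open>Take commuting roots \<open>H\<close> of \<open>X + \<epsilon>\<close> and
  \<open>K\<close> of \<open>c - X + \<epsilon>\<close>. The normal element \<open>H + J * K\<close>
  times its adjoint is \<open>c + 2 * \<epsilon>\<close>; its real part \<open>H\<close> thus has
  norm at most \<open>sqrt (c + 2 * \<epsilon>)\<close>, and
  \<open>X = H * H - \<epsilon>\<close>.\<close>

lemma norm_le_if_pos:
  assumes X: "pos X" and Y: "pos (c *\<^sub>R 1 - X)" and c: "0 \<le> c"
  shows "norm X \<le> c"
proof (rule field_le_epsilon)
  fix \<delta> :: real assume d: "0 < \<delta>"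
  define \<epsilon> where "\<epsilon> = \<delta> / 3"
  have e: "0 < \<epsilon>" using d by (simp add: \<epsilon>_def)
  have XY: "X * (c *\<^sub>R 1 - X) = (c *\<^sub>R 1 - X) * X" by (simp add: algebra_simps)
  obtain H K where HK: "adj H H" "adj K K" "H * H = X + \<epsilon> *\<^sub>R 1"
      "K * K = (c *\<^sub>R 1 - X) + \<epsilon> *\<^sub>R 1" "H * K = K * H"
    using pos_sqrt_commuting[OF X Y XY e(1)] by blast
  have JK: "J * K = K * J" and JH: "J * H = H * J" using HK J_commute by auto
  have "adj (J * K) (- (J * K))" using adj_mult[OF adj_J HK(2)] JK by simp
  then have u: "adj (H + J * K) (H - J * K)" using adj_add[OF HK(1)] by fastforce
  have JKJK: "(J * K) * (J * K) = - (K * K)" by (rule J_mult_square[OF JK])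
  have "H * (J * K) = (J * H) * K" by (simp only: JH mult.assoc)
  also have "\<dots> = (J * K) * H" by (simp only: HK(5) mult.assoc)
  finally have HJK: "H * (J * K) = (J * K) * H" .
  have sum: "H * H + K * K = (c + 2 * \<epsilon>) *\<^sub>R 1" unfolding HK(3,4) by (simp add: algebra_simps flip: scaleR_add_left)
  have "(H - J * K) * (H + J * K) = H * H + K * K" "(H + J * K) * (H - J * K) = H * H + K * K"
    by (simp_all only: left_diff_distrib right_diff_distrib distrib_left distrib_right HJK JKJK) simp_all
  moreover have "norm ((c + 2 * \<epsilon>) *\<^sub>R (1::'b)) \<le> c + 2 * \<epsilon>"
    using c e norm_one_le by (simp add: mult_left_le)
  ultimately have "(norm (H + J * K))\<^sup>2 \<le> c + 2 * \<epsilon>" "(norm (H - J * K))\<^sup>2 \<le> c + 2 * \<epsilon>"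
    using cstar_ineq[OF u] cstar_ineq[OF adj_sym[OF u]] sum by auto
  then have "norm (H + J * K) \<le> sqrt (c + 2 * \<epsilon>)" "norm (H - J * K) \<le> sqrt (c + 2 * \<epsilon>)"
    by (simp_all add: real_le_rsqrt)
  then have "norm ((H + J * K) + (H - J * K)) \<le> sqrt (c + 2 * \<epsilon>) + sqrt (c + 2 * \<epsilon>)"
    by (rule norm_triangle_mono)
  moreover have "(H + J * K) + (H - J * K) = 2 *\<^sub>R H" by (simp add: scaleR_2)
  ultimately have "norm H \<le> sqrt (c + 2 * \<epsilon>)" by simp
  then have "norm H * norm H \<le> sqrt (c + 2 * \<epsilon>) * sqrt (c + 2 * \<epsilon>)"
    by (intro mult_mono) (use c e in auto)
  then have "norm (H * H) \<le> c + 2 * \<epsilon>"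
    using norm_mult_ineq[of H H] c e by simp
  moreover have "norm (\<epsilon> *\<^sub>R (1::'b)) \<le> \<epsilon>" using e norm_one_le by (simp add: mult_left_le)
  ultimately have "norm (H * H - \<epsilon> *\<^sub>R 1) \<le> (c + 2 * \<epsilon>) + \<epsilon>"
    using norm_triangle_ineq4[of "H * H" "\<epsilon> *\<^sub>R 1"] by linarith
  then show "norm X \<le> c + \<delta>" using HK(3) by (simp add: \<epsilon>_def)
qed

section \<open>Positivity of \<open>A' * A\<close>\<close>

text \<open>This replaces the equality of the nonzero spectra of \<open>A' * A\<close> and \<open>A * A'\<close>; the reason is that
  \<open>A (1 + s A' A)\<^sup>k = (1 + s A A')\<^sup>k A\<close>.\<close>

lemma norm_one_plus_swap:
  assumes A: "adj A A'" and s: "0 \<le> s" and q: "1 \<le> q" and bound: "norm (1 + s *\<^sub>R (A' * A)) \<le> q"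
  shows "norm (1 + s *\<^sub>R (A * A')) \<le> q"
proof -
  define U where "U = 1 + s *\<^sub>R (A * A')"
  define W where "W = 1 + s *\<^sub>R (A' * A)"
  have U: "adj U U" unfolding U_def
    using A by (intro adj_add adj_one adj_scaleR adj_mult adj_sym[OF A])
  have UA: "U * A = A * W" by (simp add: U_def W_def algebra_simps)
  have pow: "U ^ n = 1 + s *\<^sub>R (A * (\<Sum>k<n. W ^ k) * A')" for n
  proof (induction n)
    case (Suc n)
    have "U ^ Suc n = U + s *\<^sub>R (U * A * (\<Sum>k<n. W ^ k) * A')"
      by (simp add: Suc.IH algebra_simps)
    also have "\<dots> = 1 + s *\<^sub>R (A * (1 + W * (\<Sum>k<n. W ^ k)) * A')"
      unfolding UA by (simp add: U_def algebra_simps)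
    also have "1 + W * (\<Sum>k<n. W ^ k) = (\<Sum>k<Suc n. W ^ k)"
      by (simp only: sum.lessThan_Suc_shift) (simp add: sum_distrib_left)
    finally show ?case .
  qed simp
  define C where "C = s * (norm A * norm A')"
  have C: "0 \<le> C" using s by (simp add: C_def)
  \<comment> \<open>Each of the \<open>n = 2 ^ m\<close> terms of the geometric sum in
    \<open>pow\<close> has norm at most \<open>q ^ n\<close>, so \<open>(norm U / q) ^ n\<close>
    grows at most linearly in \<open>n\<close>.\<close>
  have "norm U / q \<le> 1"
  proof (rule le_one_if_powers_grow_linearly)
    show "0 \<le> norm U / q" using q by simp
    fix m
    let ?n = "2 ^ m :: nat"
    have "norm (\<Sum>k<?n. W ^ k) \<le> (\<Sum>k<?n. q ^ ?n)"
    proof (rule sum_norm_le)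
      fix k assume "k \<in> {..<?n}"
      then have "q ^ k \<le> q ^ ?n" using q by (intro power_increasing) auto
      then show "norm (W ^ k) \<le> q ^ ?n"
        using norm_power_bound[of W q k] bound by (simp add: W_def)
    qed
    then have "norm (A * (\<Sum>k<?n. W ^ k) * A') \<le> (norm A * (?n * q ^ ?n)) * norm A'"
      by (intro order_trans[OF norm_mult_ineq] mult_mono) (use q in auto)
    then have "norm (U ^ ?n) \<le> 1 + s * ((norm A * (?n * q ^ ?n)) * norm A')"
      unfolding pow using s norm_one_le by (intro norm_triangle_mono) (auto intro: mult_left_mono)
    then have "norm U ^ ?n \<le> 1 + C * 2 ^ m * q ^ ?n"
      using sa_norm_power[OF U, of m] by (simp add: C_def algebra_simps)
    also have "\<dots> \<le> (1 + C * 2 ^ m) * q ^ ?n"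
      using q by (simp add: algebra_simps one_le_power)
    finally show "(norm U / q) ^ ?n \<le> 1 + C * 2 ^ m"
      using q by (simp add: power_divide divide_le_eq)
  qed
  then show ?thesis using q by (simp add: U_def divide_le_eq)
qed

text \<open>Since \<open>1 - t (1 - X) = (1 - t) (1 + s X)\<close> for
  \<open>s = t / (1 - t)\<close>, positivity of \<open>1 - X\<close> amounts to bounds on
  \<open>norm (1 + s *\<^sub>R X)\<close>, and these pass from \<open>A' * A\<close> to
  \<open>A * A'\<close>.\<close>

lemma pos_one_minus_swap:
  assumes A: "adj A A'" and pos: "pos (1 - A' * A)"
  shows "pos (1 - A * A')"
  unfolding pos_def
proof (intro conjI allI impI)
  show "adj (1 - A * A') (1 - A * A')" by (intro adj_diff adj_one adj_mult A adj_sym[OF A])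
  fix \<epsilon> :: real assume e: "0 < \<epsilon>"
  obtain t where t: "0 < t" "t \<le> 1/2" "norm (1 - t *\<^sub>R (1 - A' * A)) \<le> 1 + t * \<epsilon>"
    using pos_small_parameter[OF pos e, of "1/2"] by auto
  define s where "s = t / (1 - t)"
  have st: "(1 - t) * s = t" "0 \<le> s" using t by (auto simp: s_def)
  have eq: "1 - t *\<^sub>R (1 - X) = (1 - t) *\<^sub>R (1 + s *\<^sub>R X)" for X :: 'b
  proof -
    have "(1 - t) *\<^sub>R (1 + s *\<^sub>R X) = (1 - t) *\<^sub>R 1 + ((1 - t) * s) *\<^sub>R X"
      by (simp only: scaleR_add_right scaleR_scaleR)
    also have "\<dots> = 1 - t *\<^sub>R (1 - X)" by (simp only: st(1)) (simp add: algebra_simps)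
    finally show ?thesis by (rule sym)
  qed
  have "(1 - t) * norm (1 + s *\<^sub>R (A' * A)) \<le> 1 + t * \<epsilon>" using t unfolding eq by simp
  then have "norm (1 + s *\<^sub>R (A' * A)) \<le> (1 + t * \<epsilon>) / (1 - t)"
    using t by (simp add: pos_le_divide_eq mult.commute)
  moreover have "0 < t * \<epsilon>" using t e by simp
  then have "1 \<le> (1 + t * \<epsilon>) / (1 - t)" using t by (simp add: pos_le_divide_eq)
  ultimately have "norm (1 + s *\<^sub>R (A * A')) \<le> (1 + t * \<epsilon>) / (1 - t)"
    using norm_one_plus_swap[OF A st(2)] by blast
  then have "(1 - t) * norm (1 + s *\<^sub>R (A * A')) \<le> 1 + t * \<epsilon>"
    using t by (simp add: pos_le_divide_eq mult.commute)
  then have "norm (1 - t *\<^sub>R (1 - A * A')) \<le> 1 + t * \<epsilon>" using t unfolding eq by simp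
  then show "\<exists>t>0. norm (1 - t *\<^sub>R (1 - A * A')) \<le> 1 + t * \<epsilon>" using t(1) by blast
qed

text \<open>Up to sign and a factor 2, \<open>h\<close> and \<open>J * d\<close> are the real and
  imaginary parts of \<open>Y\<close>; their squares add up to twice the element in
  question.\<close>

lemma pos_symmetrised:
  assumes Y: "adj Y Y'"
  shows "pos (Y' * Y + Y * Y')"
proof -
  define h where "h = Y + Y'"
  define d where "d = Y - Y'"
  have Y': "adj Y' Y" using Y by (rule adj_sym)
  have h: "adj h h" using adj_add[OF Y Y'] by (simp add: h_def add.commute)
  have dd: "adj d (- d)" using adj_diff[OF Y Y'] by (simp add: d_def)
  have Jd: "J * d = d * J" using dd by (rule J_commute)
  have k: "adj (J * d) (J * d)" using adj_mult[OF adj_J dd] Jd by simp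
  have JdJd: "(J * d) * (J * d) = - (d * d)" by (rule J_mult_square[OF Jd])
  have "h * h + (J * d) * (J * d) = 2 *\<^sub>R (Y' * Y + Y * Y')"
    unfolding JdJd by (simp add: h_def d_def algebra_simps scaleR_2)
  then have "pos (2 *\<^sub>R (Y' * Y + Y * Y'))"
    using pos_add[OF pos_square[OF h] pos_square[OF k]] by (simp only:)
  from pos_scaleR[OF this, of "1/2"] show ?thesis by simp
qed

text \<open>With \<open>V = 1 - A' A\<close> and \<open>Y = A V\<^sup>k\<close>, the element \<open>Y' Y = (1 - V) V\<^sup>2\<^sup>k\<close> is at most 1,
  because \<open>x (1 - x)\<^sup>2\<^sup>k \<le> 1\<close> for \<open>\<bar>x\<bar> \<le> 1\<close>. Swapping and symmetrising also bounds it from below,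
  whereas a negative part of \<open>A' A\<close> would make \<open>Y' Y\<close> grow exponentially with \<open>k\<close>.\<close>

lemma pos_adj_mult_contraction:
  assumes A: "adj A A'" and le: "norm (A' * A) \<le> 1"
  shows "pos (A' * A)"
proof -
  define T where "T = A' * A"
  define V where "V = 1 - T"
  have T: "adj T T" unfolding T_def by (intro adj_mult A adj_sym[OF A])
  have V: "adj V V" unfolding V_def by (intro adj_diff adj_one T)
  have posV: "pos V" using V le by (intro pos_if_norm_one_minus_le) (auto simp: V_def T_def)
  have TV: "T * V = V * T" by (simp add: V_def algebra_simps)
  have TVn: "T * V ^ n = V ^ n * T" for n using TV by (metis power_commuting_commutes)
  have posVn: "pos (V ^ n)" for n
  proof (induction n)
    case 0
    then show ?case using adj_one by (simp add: pos_if_norm_one_minus_le)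
  next
    case (Suc n)
    then have "pos (V * V ^ n)" by (intro pos_mult posV) (simp_all add: power_commutes)
    then show ?case by simp
  qed
  have geom: "T * (\<Sum>j<n. V ^ j) = 1 - V ^ n" for n
  proof (induction n)
    case (Suc n)
    then show ?case by (simp add: distrib_left) (simp add: V_def algebra_simps)
  qed simp
  have bound: "norm (T * V ^ (2 * k)) \<le> 3" for k
  proof -
    define Y where "Y = A * V ^ k"
    define Y' where "Y' = V ^ k * A'"
    have Y: "adj Y Y'" unfolding Y_def Y'_def using A V by (intro adj_mult sa_power)
    have "Y' * Y = V ^ k * T * V ^ k" by (simp add: Y_def Y'_def T_def mult.assoc)
    also have "\<dots> = T * V ^ (2 * k)" unfolding TVn[symmetric] by (simp only: mult.assoc mult_2 power_add)
    finally have YY: "Y' * Y = T * V ^ (2 * k)" .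
    \<comment> \<open>The geometric sum turns \<open>1 - V ^ (2 * k)\<close> into a multiple of
      \<open>T\<close>, so \<open>1 - Y' * Y\<close> becomes \<open>V\<close> plus a product of
      commuting positive elements.\<close>
    have "1 - T * V ^ (2 * k) = V + T * (T * (\<Sum>j<2 * k. V ^ j))"
      unfolding geom by (simp add: V_def algebra_simps)
    moreover have "pos ((T * T) * (\<Sum>j<2 * k. V ^ j))"
    proof (rule pos_mult)
      show "pos (T * T)" using T by (rule pos_square)
      show "pos (\<Sum>j<2 * k. V ^ j)" using posVn by (intro pos_sum)
      have "T * (\<Sum>j<2 * k. V ^ j) = (\<Sum>j<2 * k. V ^ j) * T"
        by (simp only: sum_distrib_left sum_distrib_right TVn)
      then show "T * T * (\<Sum>j<2 * k. V ^ j) = (\<Sum>j<2 * k. V ^ j) * (T * T)"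
        by (simp only: mult.assoc) (simp only: mult.assoc[symmetric])
    qed
    ultimately have upper: "pos (1 - Y' * Y)" using pos_add[OF posV] by (simp add: YY mult.assoc)
    \<comment> \<open>The swap gives \<open>1 - Y * Y' \<ge> 0\<close>; adding the symmetrised
      element removes \<open>Y * Y'\<close> and leaves the lower bound
      \<open>Y' * Y \<ge> -1\<close>.\<close>
    have "pos ((1 - Y * Y') + (Y' * Y + Y * Y'))"
      by (intro pos_add pos_one_minus_swap[OF Y upper] pos_symmetrised[OF Y])
    then have lower: "pos (1 + Y' * Y)" by (simp add: algebra_simps)
    have "norm (1 + Y' * Y) \<le> 2"
    proof (rule norm_le_if_pos[OF lower])
      have "2 *\<^sub>R 1 - (1 + Y' * Y) = 1 - Y' * Y" by (simp add: scaleR_2)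
      then show "pos (2 *\<^sub>R 1 - (1 + Y' * Y))" using upper by (simp only:)
    qed simp
    then have "norm ((1 + Y' * Y) - 1) \<le> 2 + 1"
      using norm_one_le norm_triangle_ineq4[of "1 + Y' * Y" 1] by linarith
    then show ?thesis by (simp add: YY)
  qed
  have nV: "norm V \<le> 2"
    using norm_one_le le norm_triangle_ineq4[of 1 T] by (simp add: V_def T_def)
  have bound': "norm (T * V ^ j) \<le> 6" for j
  proof (cases "even j")
    case True
    then obtain k where "j = 2 * k" by (auto elim: evenE)
    then show ?thesis using bound[of k] by simp
  next
    case False
    then obtain k where k: "j = 2 * k + 1" by (auto elim: oddE)
    have "norm ((T * V ^ (2 * k)) * V) \<le> 3 * 2"
      using bound nV by (intro order_trans[OF norm_mult_ineq mult_mono]) auto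
    then show ?thesis by (simp add: k mult.assoc power_commutes)
  qed
  \<comment> \<open>By the geometric sum, \<open>V ^ n\<close> differs from 1 by \<open>n\<close>
    terms of norm at most 6. Such linear growth forces \<open>norm V \<le> 1\<close>, that is,
    \<open>norm (1 - T) \<le> 1\<close>.\<close>
  have "norm V \<le> 1"
  proof (rule le_one_if_powers_grow_linearly)
    fix m
    let ?n = "2 ^ m :: nat"
    have "norm (T * (\<Sum>j<?n. V ^ j)) \<le> (\<Sum>j<?n. 6)"
      unfolding sum_distrib_left by (intro sum_norm_le bound')
    then have "norm (1 - T * (\<Sum>j<?n. V ^ j)) \<le> 1 + 6 * 2 ^ m"
      using norm_one_le norm_triangle_ineq4[of 1 "T * (\<Sum>j<?n. V ^ j)"] by simp
    then show "norm V ^ ?n \<le> 1 + 6 * 2 ^ m"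
      using sa_norm_power[OF V, of m] unfolding geom by simp
  qed simp
  then show ?thesis using T by (intro pos_if_norm_one_minus_le) (auto simp: V_def T_def)
qed

lemma pos_adj_mult:
  assumes A: "adj A A'"
  shows "pos (A' * A)"
proof -
  define k where "k = norm (A' * A) + 1"
  have k: "0 < k" by (simp add: k_def add_nonneg_pos)
  define c where "c = 1 / sqrt k"
  have cc: "c * c = 1 / k" using k by (simp add: c_def)
  have "norm ((1 / k) *\<^sub>R (A' * A)) \<le> 1" using k by (simp add: k_def divide_le_eq)
  then have "pos ((1 / k) *\<^sub>R (A' * A))"
    using pos_adj_mult_contraction[OF adj_scaleR[OF A, of c]] cc by simp
  from pos_scaleR[OF this, of k] k show ?thesis by simp
qed

text \<open>The single term lies between 0 and the full sum, which in turn is bounded by its own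
  norm times the unit.\<close>

lemma norm_le_norm_sum:
  assumes A: "\<And>i. i \<in> I \<Longrightarrow> adj (A i) (A' i)" and I: "finite I" "j \<in> I"
  shows "norm (A' j * A j) \<le> norm (\<Sum>i\<in>I. A' i * A i)"
proof (rule norm_le_if_pos)
  let ?S = "\<Sum>i\<in>I. A' i * A i"
  show "pos (A' j * A j)" using A I by (intro pos_adj_mult) auto
  have "adj ?S ?S" using A by (intro pos_sa pos_sum pos_adj_mult)
  then have "pos (norm ?S *\<^sub>R 1 - ?S)" by (rule pos_one_minus) simp
  moreover have "pos (\<Sum>i\<in>I - {j}. A' i * A i)" using A by (intro pos_sum pos_adj_mult) auto
  ultimately have "pos ((norm ?S *\<^sub>R 1 - ?S) + (\<Sum>i\<in>I - {j}. A' i * A i))" by (rule pos_add)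
  moreover have "(c - ?S) + (\<Sum>i\<in>I - {j}. A' i * A i) = c - A' j * A j" for c
    unfolding sum.remove[OF I] by simp
  ultimately show "pos (norm ?S *\<^sub>R 1 - A' j * A j)" by (simp only:)
qed simp

end

section \<open>C*-algebras acting on themselves\<close>

locale cstar =
  fixes scC :: "complex \<Rightarrow> 'a::{real_normed_algebra,banach} \<Rightarrow> 'a" and st :: "'a \<Rightarrow> 'a"
  assumes cstar: "cstar_algebra scC st"
begin

lemma scC_real: "scC (complex_of_real r) x = r *\<^sub>R x"
  and scC_add: "scC c (x + y) = scC c x + scC c y"
  and scC_add_left: "scC (c + d) x = scC c x + scC d x"
  and scC_scC: "scC c (scC d x) = scC (c * d) x"
  and scC_mult_left: "scC c (x * y) = scC c x * y"
  and scC_mult_right: "scC c (x * y) = x * scC c y"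
  and norm_scC: "norm (scC c x) = cmod c * norm x"
  and st_add: "st (x + y) = st x + st y"
  and st_scC: "st (scC c x) = scC (cnj c) (st x)"
  and st_mult: "st (x * y) = st y * st x"
  and st_st [simp]: "st (st x) = x"
  and norm_st_mult: "norm (st x * x) = (norm x)\<^sup>2"
  using cstar unfolding cstar_algebra_def by meson+

lemma st_scaleR: "st (r *\<^sub>R x) = r *\<^sub>R st x"
  using st_scC[of "complex_of_real r" x] by (simp add: scC_real)

lemma scC_minus_left: "scC (- c) x = - scC c x"
  using scC_scC[of "complex_of_real (-1)" c x] scC_real[of "-1" "scC c x"] by simp

lemma scC_scaleR: "scC c (r *\<^sub>R x) = r *\<^sub>R scC c x"
  using scC_scC[of c "complex_of_real r" x] scC_scC[of "complex_of_real r" c x]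
  by (simp add: scC_real mult.commute)

lemma norm_st [simp]: "norm (st x) = norm x"
proof -
  have le: "norm y \<le> norm (st y)" for y
  proof (cases "y = 0")
    case False
    have "norm y * norm y \<le> norm (st y) * norm y"
      using norm_st_mult[of y] norm_mult_ineq[of "st y" y] by (simp add: power2_eq_square)
    then show ?thesis using False by simp
  qed simp
  show ?thesis using le[of x] le[of "st x"] by simp
qed

lemma bounded_linear_st: "bounded_linear st"
  by (rule bounded_linear_intro[where K = 1]) (simp_all add: st_add st_scaleR)

lemma bounded_linear_scC: "bounded_linear (scC c)"
  by (rule bounded_linear_intro[where K = "cmod c"])
     (simp_all add: scC_add scC_scaleR norm_scC)

lemma eq_if_st_mult_eq:
  assumes "\<And>x. st x * u = st x * v"
  shows "u = v"
proof -
  have "st (u - v) * (u - v) = 0" using assms by (simp add: right_diff_distrib)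
  then show ?thesis using norm_st_mult[of "u - v"] by simp
qed

text \<open>The algebra is regarded as a Hilbert module over itself with inner product
  \<open>st x * y\<close>.\<close>

definition adj :: "'a endo \<Rightarrow> 'a endo \<Rightarrow> bool"
  where "adj S S' \<longleftrightarrow> (\<forall>x y. st (endo_apply S x) * y = st x * endo_apply S' y)"

definition J :: "'a endo"
  where "J = endo_of (scC \<i>)"

definition L :: "'a \<Rightarrow> 'a endo"
  where "L a = endo_of (\<lambda>x. a * x)"

lemma J_apply [simp]: "endo_apply J x = scC \<i> x"
  by (simp add: J_def endo_apply_endo_of bounded_linear_scC)

lemma L_apply [simp]: "endo_apply (L a) x = a * x"
  by (simp add: L_def endo_apply_endo_of bounded_linear_mult_right)

lemma adj_symmetric:
  assumes "adj S S'"
  shows "adj S' S"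
  unfolding adj_def
proof (intro allI)
  fix x y
  have "st (st (endo_apply S y) * x) = st (st y * endo_apply S' x)"
    using assms unfolding adj_def by simp
  then show "st (endo_apply S' x) * y = st x * endo_apply S y"
    by (simp add: st_mult)
qed

sublocale adjoint_algebra adj J
proof
  fix S S' T T' :: "'a endo" and c :: real
  show "adj S S' \<Longrightarrow> adj S' S" by (rule adj_symmetric)
  show "adj 1 1" by (simp add: adj_def)
  show "adj S S' \<Longrightarrow> adj T T' \<Longrightarrow> adj (S + T) (S' + T')"
    by (simp add: adj_def st_add algebra_simps)
  show "adj S S' \<Longrightarrow> adj (c *\<^sub>R S) (c *\<^sub>R S')"
    by (simp add: adj_def st_scaleR)
  show "adj S S' \<Longrightarrow> adj T T' \<Longrightarrow> adj (S * T) (T' * S')"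
    by (simp add: adj_def)
  have "closed {S. st (endo_apply S x) * y = st x * endo_apply S y}" for x y
    by (intro closed_Collect_eq continuous_intros
        bounded_linear.continuous_on[OF bounded_linear_st]
        bounded_linear.continuous_on[OF bounded_linear_endo_apply_left])
  then have "closed (\<Inter>x. \<Inter>y. {S. st (endo_apply S x) * y = st x * endo_apply S y})"
    by (intro closed_INT) auto
  moreover have "{S. adj S S} = (\<Inter>x. \<Inter>y. {S. st (endo_apply S x) * y = st x * endo_apply S y})"
    by (auto simp: adj_def)
  ultimately show "closed {S. adj S S}" by simp
  show "(norm S)\<^sup>2 \<le> norm (S' * S)" if "adj S S'"
  proof -
    have "norm S \<le> sqrt (norm (S' * S))"
    proof (rule norm_endo_bound)
      fix x
      have "(norm (endo_apply S x))\<^sup>2 = norm (st x * endo_apply (S' * S) x)"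
        using that by (simp add: adj_def flip: norm_st_mult)
      also have "\<dots> \<le> norm x * (norm (S' * S) * norm x)"
        by (rule order_trans[OF norm_mult_ineq]) (simp add: mult_left_mono norm_endo_apply_le del: endo_apply_simps)
      also have "\<dots> = (sqrt (norm (S' * S)) * norm x)\<^sup>2"
        by (simp add: power_mult_distrib) (simp add: power2_eq_square)
      finally show "norm (endo_apply S x) \<le> sqrt (norm (S' * S)) * norm x"
        by (rule power2_le_imp_le) simp
    qed simp
    then have "(norm S)\<^sup>2 \<le> (sqrt (norm (S' * S)))\<^sup>2" by (intro power_mono) auto
    then show ?thesis by simp
  qed
  show "adj J (- J)" by (simp add: adj_def st_scC scC_minus_left flip: scC_mult_left scC_mult_right)
  show "J * J = - 1"
    using scC_real[of "-1"] by (intro endo_eqI) (simp add: scC_scC)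
  \<comment> \<open>Elements of \<open>endo\<close> are only real-linear. An adjoint forces complex
    linearity, because scalars can be pulled out of the second argument of the inner
    product.\<close>
  show "J * S = S * J" if "adj S S'"
  proof (rule endo_eqI, rule eq_if_st_mult_eq)
    fix x u
    have *: "st u * endo_apply S y = st (endo_apply S' u) * y" for y
      using adj_symmetric[OF that] by (simp add: adj_def)
    show "st u * endo_apply (J * S) x = st u * endo_apply (S * J) x"
      by (simp add: * flip: scC_mult_right)
  qed
  show "norm (1 :: 'a endo) \<le> 1" by (rule norm_endo_bound) auto
qed

lemma adj_L: "adj (L a) (L (st a))"
  by (simp add: adj_def st_mult mult.assoc)

lemma L_add: "L (a + b) = L a + L b"
  by (rule endo_eqI) (simp add: distrib_right)

lemma L_diff: "L (a - b) = L a - L b"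
  by (rule endo_eqI) (simp add: left_diff_distrib)

lemma L_mult: "L (a * b) = L a * L b"
  by (rule endo_eqI) (simp add: mult.assoc)

lemma L_scaleR: "L (r *\<^sub>R a) = r *\<^sub>R L a"
  by (rule endo_eqI) simp

lemma L_sum: "L (sum f I) = (\<Sum>i\<in>I. L (f i))"
proof -
  have "L 0 = 0" by (rule endo_eqI) simp
  then show ?thesis by (induction I rule: infinite_finite_induct) (auto simp: L_add)
qed

text \<open>Without a unit to test on, the lower bound is read off at \<open>st a\<close>, where the
  C*-identity gives \<open>norm (a * st a) = (norm a)\<^sup>2\<close>.\<close>

lemma norm_L: "norm (L a) = norm a"
proof (rule antisym)
  show "norm (L a) \<le> norm a" by (rule norm_endo_bound) (auto simp: norm_mult_ineq)
  have "norm a * norm a \<le> norm (L a) * norm a"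
    using norm_endo_apply_le[of "L a" "st a"] norm_st_mult[of "st a"] by (simp add: power2_eq_square)
  then show "norm a \<le> norm (L a)" by (cases "a = 0") auto
qed

lemma norm_square_le_norm_sum:
  assumes "finite I" "j \<in> I"
  shows "(norm (a j))\<^sup>2 \<le> norm (\<Sum>i\<in>I. st (a i) * a i)"
proof -
  have "norm (L (st (a j)) * L (a j)) \<le> norm (\<Sum>i\<in>I. L (st (a i)) * L (a i))"
    using assms adj_L by (intro norm_le_norm_sum)
  then have "norm (L (st (a j) * a j)) \<le> norm (L (\<Sum>i\<in>I. st (a i) * a i))"
    by (simp only: L_mult L_sum)
  then show ?thesis by (simp only: norm_L norm_st_mult)
qed

text \<open>If \<open>x\<close> is self-adjoint with \<open>\<parallel>x\<parallel> < 1\<close>, then \<open>1 - x\<^sup>2 = (1 - r)\<^sup>2\<close> for some self-adjoint \<open>r\<close>.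
  Being algebraic, this relation is preserved by \<open>\<phi>\<close>.\<close>

lemma star_hom_contractive:
  assumes add: "\<And>x y. \<phi> (x + y) = \<phi> x + \<phi> y"
    and scale: "\<And>c x. \<phi> (scC c x) = scC c (\<phi> x)"
    and mult: "\<And>x y. \<phi> (x * y) = \<phi> x * \<phi> y"
    and star: "\<And>x. \<phi> (st x) = st (\<phi> x)"
  shows "norm (\<phi> x) \<le> norm x"
proof -
  have scaleR: "\<phi> (r *\<^sub>R x) = r *\<^sub>R \<phi> x" for r x
    using scale[of "complex_of_real r" x] by (simp add: scC_real)
  have diff: "\<phi> (x - y) = \<phi> x - \<phi> y" for x y
    using add[of "x - y" y] by (simp add: eq_diff_eq)
  have sa: "norm (\<phi> x) \<le> 1" if x: "norm x < 1" "st x = x" for x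
  proof -
    define y where "y = x * x"
    have "norm y = (norm x)\<^sup>2" using norm_st_mult[of x] x by (simp add: y_def)
    also have "\<dots> < 1" using x by (simp add: power_less_one_iff abs_square_less_1)
    finally have y: "norm y < 1" .
    have "st y = y" using x by (simp add: y_def st_mult)
    obtain r where r: "st r = r" "2 *\<^sub>R r - r * r = y"
    proof (rule banach_algebra_sqrt[of y "norm y" "{r. st r = r}"])
      show "closed {r. st r = r}"
        by (intro closed_Collect_eq continuous_intros bounded_linear.continuous_on[OF bounded_linear_st])
      show "0 \<in> {r. st r = r}" using st_scaleR[of 0 0] by simp
    qed (use y \<open>st y = y\<close> in \<open>auto simp: st_scaleR st_add st_mult\<close>)
    have "adj (L (\<phi> x)) (L (\<phi> x))" using adj_L[of "\<phi> x"] x star[of x] by simp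
    then have "pos (L (\<phi> x) * L (\<phi> x))" by (rule pos_square)
    then have 1: "pos (L (\<phi> y))" by (simp add: y_def mult L_mult)
    have "adj (1 - L (\<phi> r)) (1 - L (\<phi> r))"
      using adj_L[of "\<phi> r"] r star[of r] by (intro adj_diff adj_one) simp
    then have "pos ((1 - L (\<phi> r)) * (1 - L (\<phi> r)))" by (rule pos_square)
    \<comment> \<open>The relation \<open>2 *\<^sub>R r - r * r = y\<close> can be mapped by
      \<open>\<phi>\<close> without a unit; the unit of \<open>endo\<close> then completes the
      square, so that \<open>0 \<le> L (\<phi> y) \<le> 1\<close>.\<close>
    moreover have "(1 - L (\<phi> r)) * (1 - L (\<phi> r)) = 1 *\<^sub>R 1 - L (\<phi> y)"
      by (simp add: add diff scaleR mult L_add L_diff L_scaleR L_mult scaleR_2 algebra_simps flip: r(2))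
    ultimately have "norm (L (\<phi> y)) \<le> 1" using norm_le_if_pos[OF 1, of 1] by simp
    moreover have "norm (\<phi> y) = (norm (\<phi> x))\<^sup>2"
      using norm_st_mult[of "\<phi> x"] x star[of x] by (simp add: y_def mult)
    ultimately show ?thesis by (simp add: norm_L power_le_one_iff abs_square_le_1)
  qed
  have contr: "norm (\<phi> x) \<le> 1" if x: "norm x < 1" for x
  proof -
    have "norm (st x * x) < 1" using x by (simp add: norm_st_mult abs_square_less_1)
    then have "norm (\<phi> (st x * x)) \<le> 1" by (rule sa) (simp add: st_mult)
    then have "(norm (\<phi> x))\<^sup>2 \<le> 1" by (simp add: mult star norm_st_mult)
    then show ?thesis by (simp add: abs_square_le_1)
  qed
  show ?thesis
  proof (rule field_le_epsilon)
    fix \<epsilon> :: real assume e: "0 < \<epsilon>"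
    let ?n = "norm x + \<epsilon>"
    have n: "0 < ?n" using e by (simp add: add_nonneg_pos)
    then have "norm (\<phi> ((1 / ?n) *\<^sub>R x)) \<le> 1" using e by (intro contr) simp
    then show "norm (\<phi> x) \<le> ?n" using n by (simp add: scaleR divide_le_eq)
  qed
qed

end

section \<open>Ideals of the crossed product\<close>

text \<open>The family \<open>v\<close> may repeat vectors, whereas \<open>fin_codim\<close> wants
  one coefficient per element of a set; the coefficients over each fibre of \<open>v\<close> are
  added up.\<close>

lemma fin_codimI:
  fixes v :: "'k \<Rightarrow> 'b::ab_group_add"
  assumes K: "finite K" "\<And>k. k \<in> K \<Longrightarrow> v k \<in> C"
    and sc_add: "\<And>c d x. sc (c + d) x = sc c x + sc d x"
    and span: "\<And>x. x \<in> C \<Longrightarrow> \<exists>c. \<exists>y\<in>I. x = (\<Sum>k\<in>K. sc (c k) (v k)) + y"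
  shows "fin_codim sc C I"
  unfolding fin_codim_def
proof (intro exI[of _ "v ` K"] conjI ballI)
  show "finite (v ` K)" "v ` K \<subseteq> C" using K by auto
  fix x assume "x \<in> C"
  then obtain c y where y: "y \<in> I" "x = (\<Sum>k\<in>K. sc (c k) (v k)) + y" using span by blast
  have sc0: "sc 0 s = 0" for s using sc_add[of 0 0 s] by simp
  have sc_sum: "sc (sum c A) s = (\<Sum>k\<in>A. sc (c k) s)" for A s
    by (induction A rule: infinite_finite_induct) (auto simp: sc0 sc_add)
  have "(\<Sum>k\<in>K. sc (c k) (v k)) = (\<Sum>s\<in>v ` K. \<Sum>k\<in>{k\<in>K. v k = s}. sc (c k) (v k))"
    by (rule sum.image_gen) (rule K)
  also have "\<dots> = (\<Sum>s\<in>v ` K. sc (sum c {k\<in>K. v k = s}) s)"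
    unfolding sc_sum by (intro sum.cong) auto
  finally have "x = (\<Sum>s\<in>v ` K. sc (sum c {k\<in>K. v k = s}) s) + y" using y by simp
  then show "\<exists>c. \<exists>y\<in>I. x = (\<Sum>s\<in>v ` K. sc (c s) s) + y" using y(1) by (intro exI bexI)
qed

lemma sum_fun_apply: "sum f A x = (\<Sum>i\<in>A. f i x)"
  by (induction A rule: infinite_finite_induct) auto

text \<open>The element usually written \<open>a u_g\<close>; \<open>delta a \<one>\<close> is the
  image of \<open>a\<close> in the crossed product.\<close>

definition delta :: "'a::zero \<Rightarrow> 'g \<Rightarrow> 'g \<Rightarrow> 'a"
  where "delta a g = (\<lambda>h. if h = g then a else 0)"

section \<open>Coefficients and norm of the crossed product\<close>

locale crossed_product = cstar scC st + group G
  for scC :: "complex \<Rightarrow> 'a::{real_normed_algebra,banach} \<Rightarrow> 'a" and st :: "'a \<Rightarrow> 'a"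
    and G :: "('g, 'm) monoid_scheme" (structure) +
  fixes \<alpha> :: "'g \<Rightarrow> 'a \<Rightarrow> 'a"
  assumes fin: "finite (carrier G)"
    and act: "cstar_action G scC st \<alpha>"
begin

lemma \<alpha>_add: "g \<in> carrier G \<Longrightarrow> \<alpha> g (x + y) = \<alpha> g x + \<alpha> g y"
  and \<alpha>_scC: "g \<in> carrier G \<Longrightarrow> \<alpha> g (scC c x) = scC c (\<alpha> g x)"
  and \<alpha>_mult: "g \<in> carrier G \<Longrightarrow> \<alpha> g (x * y) = \<alpha> g x * \<alpha> g y"
  and \<alpha>_st: "g \<in> carrier G \<Longrightarrow> \<alpha> g (st x) = st (\<alpha> g x)"
  and \<alpha>_one [simp]: "\<alpha> \<one> x = x"
  and \<alpha>_comp: "g \<in> carrier G \<Longrightarrow> h \<in> carrier G \<Longrightarrow> \<alpha> (g \<otimes> h) x = \<alpha> g (\<alpha> h x)"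
  using act unfolding cstar_action_def by blast+

lemma \<alpha>_zero: "g \<in> carrier G \<Longrightarrow> \<alpha> g 0 = 0"
  using \<alpha>_add[of g 0 0] by simp

lemma norm_\<alpha>_le: "g \<in> carrier G \<Longrightarrow> norm (\<alpha> g x) \<le> norm x"
  by (intro star_hom_contractive \<alpha>_add \<alpha>_scC \<alpha>_mult \<alpha>_st)

lemma norm_hm_le:
  assumes "norm (hm_inner G st \<xi> \<xi>) \<le> 1" "g \<in> carrier G"
  shows "norm (\<xi> g) \<le> 1"
proof -
  have "(norm (\<xi> g))\<^sup>2 \<le> 1"
    using norm_square_le_norm_sum[OF fin assms(2), of \<xi>] assms(1) by (simp add: hm_inner_def)
  then show ?thesis by (simp add: abs_square_le_1)
qed

text \<open>Coordinates of \<open>\<xi>\<close> and \<open>\<eta>\<close> have norm at most 1 and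
  \<open>\<alpha>\<close> is contractive, so each summand of the double sum has norm at most
  \<open>e\<close>. The lower bound also relies on this, since the supremum must be that of a
  bounded set.\<close>

lemma cp_norm_bounds:
  fixes e :: real
  assumes f: "\<And>h. h \<in> carrier G \<Longrightarrow> norm (f h) \<le> e"
  shows "0 \<le> cp_norm G st \<alpha> f" "cp_norm G st \<alpha> f \<le> (real (card (carrier G)))\<^sup>2 * e"
proof -
  let ?N = "{norm (hm_inner G st \<xi> (reg_rep G \<alpha> f \<eta>)) | \<xi> \<eta>.
       norm (hm_inner G st \<xi> \<xi>) \<le> 1 \<and> norm (hm_inner G st \<eta> \<eta>) \<le> 1}"
  have zero: "0 \<in> ?N"
  proof -
    have "hm_inner G st (\<lambda>_. 0) \<zeta> = 0" for \<zeta>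
      using st_scaleR[of 0 0] by (simp add: hm_inner_def)
    then show ?thesis by (force intro!: exI[of _ "\<lambda>_. 0"])
  qed
  have bound: "norm (hm_inner G st \<xi> (reg_rep G \<alpha> f \<eta>)) \<le> (real (card (carrier G)))\<^sup>2 * e"
    if \<xi>: "norm (hm_inner G st \<xi> \<xi>) \<le> 1" and \<eta>: "norm (hm_inner G st \<eta> \<eta>) \<le> 1" for \<xi> \<eta>
  proof -
    have summand: "norm (\<alpha> (inv g) (f h) * \<eta> (inv h \<otimes> g)) \<le> e"
      if gh: "g \<in> carrier G" "h \<in> carrier G" for g h
    proof -
      have "norm (\<alpha> (inv g) (f h)) * norm (\<eta> (inv h \<otimes> g)) \<le> e * 1"
      proof (rule mult_mono)
        show "norm (\<alpha> (inv g) (f h)) \<le> e"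
          using gh by (intro order_trans[OF norm_\<alpha>_le f]) auto
        show "norm (\<eta> (inv h \<otimes> g)) \<le> 1" using gh by (intro norm_hm_le[OF \<eta>]) auto
        show "0 \<le> e" using order_trans[OF norm_ge_zero f[OF gh(2)]] .
      qed simp
      then show ?thesis by (intro order_trans[OF norm_mult_ineq]) simp
    qed
    have "norm (st (\<xi> g) * reg_rep G \<alpha> f \<eta> g) \<le> card (carrier G) * e" if g: "g \<in> carrier G" for g
    proof -
      have "norm (reg_rep G \<alpha> f \<eta> g) \<le> (\<Sum>h\<in>carrier G. e)"
        unfolding reg_rep_def using g by (intro sum_norm_le summand)
      then have "norm (st (\<xi> g)) * norm (reg_rep G \<alpha> f \<eta> g) \<le> 1 * (card (carrier G) * e)"
        using norm_hm_le[OF \<xi> g] by (intro mult_mono) auto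
      then show ?thesis by (intro order_trans[OF norm_mult_ineq]) simp
    qed
    then have "norm (hm_inner G st \<xi> (reg_rep G \<alpha> f \<eta>)) \<le> (\<Sum>g\<in>carrier G. card (carrier G) * e)"
      unfolding hm_inner_def by (intro sum_norm_le)
    then show ?thesis by (simp add: power2_eq_square mult.assoc)
  qed
  then have "bdd_above ?N" by (auto intro!: bdd_aboveI)
  with zero show "0 \<le> cp_norm G st \<alpha> f" unfolding cp_norm_def by (intro cSup_upper)
  show "cp_norm G st \<alpha> f \<le> (real (card (carrier G)))\<^sup>2 * e"
    unfolding cp_norm_def using zero bound by (intro cSup_least) blast+
qed

lemma delta_in_cp_carrier: "g \<in> carrier G \<Longrightarrow> delta a g \<in> cp_carrier G"
  by (auto simp: delta_def cp_carrier_def)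

lemma delta_add: "delta (a + b :: 'a) g = delta a g + delta b g"
  by (rule ext) (simp add: delta_def)

lemma cp_scale_delta: "cp_scale scC c (delta a g) = delta (scC c a) g"
  using scC_add[of c 0 0] by (auto simp: cp_scale_def delta_def)

lemma cp_mult_delta_left:
  assumes f: "f \<in> cp_carrier G"
  shows "cp_mult G \<alpha> (delta a \<one>) f = (\<lambda>g. a * f g)"
proof
  fix g
  have "(\<Sum>h\<in>carrier G. delta a \<one> h * \<alpha> h (f (inv h \<otimes> g))) = a * f g" if "g \<in> carrier G"
  proof -
    have "(\<Sum>h\<in>carrier G. delta a \<one> h * \<alpha> h (f (inv h \<otimes> g)))
        = (\<Sum>h\<in>carrier G. if h = \<one> then a * \<alpha> h (f (inv h \<otimes> g)) else 0)"
      by (intro sum.cong) (auto simp: delta_def)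
    also have "\<dots> = a * f g" using that by (simp add: sum.delta fin)
    finally show ?thesis .
  qed
  then show "cp_mult G \<alpha> (delta a \<one>) f g = a * f g"
    using f by (auto simp: cp_mult_def cp_carrier_def)
qed

lemma cp_mult_delta_right:
  assumes k: "k \<in> carrier G" and g: "g \<in> carrier G"
  shows "cp_mult G \<alpha> f (delta a k) g = f (g \<otimes> inv k) * \<alpha> (g \<otimes> inv k) a"
proof -
  have "cp_mult G \<alpha> f (delta a k) g = (\<Sum>h\<in>carrier G. f h * \<alpha> h (delta a k (inv h \<otimes> g)))"
    using g by (simp add: cp_mult_def)
  also have "\<dots> = (\<Sum>h\<in>carrier G. if h = g \<otimes> inv k then f h * \<alpha> h a else 0)"
  proof (intro sum.cong refl)
    fix h assume h: "h \<in> carrier G"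
    have "inv h \<otimes> g = k \<longleftrightarrow> h = g \<otimes> inv k"
      using h g k by (metis inv_solve_left inv_solve_right)
    then show "f h * \<alpha> h (delta a k (inv h \<otimes> g)) = (if h = g \<otimes> inv k then f h * \<alpha> h a else 0)"
      using h by (simp add: delta_def \<alpha>_zero)
  qed
  also have "\<dots> = f (g \<otimes> inv k) * \<alpha> (g \<otimes> inv k) a" using g k by (simp add: sum.delta fin)
  finally show ?thesis .
qed

section \<open>Closed ideals and their intersection with the coefficient algebra\<close>

definition cp_ideal :: "('g \<Rightarrow> 'a) set \<Rightarrow> bool"
  where "cp_ideal I \<longleftrightarrow> closed_ideal (cp_carrier G) (cp_scale scC) (cp_mult G \<alpha>) (cp_norm G st \<alpha>) I"

lemma cp_idealD:
  assumes "cp_ideal I"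
  shows "I \<subseteq> cp_carrier G" "0 \<in> I"
    "\<And>x y. x \<in> I \<Longrightarrow> y \<in> I \<Longrightarrow> x + y \<in> I"
    "\<And>c x. x \<in> I \<Longrightarrow> cp_scale scC c x \<in> I"
    "\<And>a x. a \<in> cp_carrier G \<Longrightarrow> x \<in> I \<Longrightarrow> cp_mult G \<alpha> a x \<in> I"
    "\<And>a x. a \<in> cp_carrier G \<Longrightarrow> x \<in> I \<Longrightarrow> cp_mult G \<alpha> x a \<in> I"
  using assms unfolding cp_ideal_def closed_ideal_def by auto

lemma cp_ideal_sum:
  assumes "cp_ideal I" "\<And>i. i \<in> A \<Longrightarrow> f i \<in> I"
  shows "sum f A \<in> I"
  using assms(2)
  by (induction A rule: infinite_finite_induct) (auto simp: cp_idealD[OF assms(1)])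

text \<open>Uniform convergence of coefficients implies convergence in \<open>cp_norm\<close>, by
  the crude upper bound above. Later arguments therefore estimate coefficients only.\<close>

lemma cp_ideal_limit:
  assumes I: "cp_ideal I" and x: "x \<in> cp_carrier G"
    and approx: "\<And>e. 0 < e \<Longrightarrow> \<exists>y\<in>I. \<forall>h\<in>carrier G. norm (y h - x h) \<le> e"
  shows "x \<in> I"
proof -
  have "\<exists>y. y \<in> I \<and> (\<forall>h\<in>carrier G. norm (y h - x h) \<le> inverse (real (Suc n)))" for n
    using approx[of "inverse (real (Suc n))"] by (simp only: Bex_def) simp
  then obtain X where X: "\<And>n. X n \<in> I"
      "\<And>n h. h \<in> carrier G \<Longrightarrow> norm (X n h - x h) \<le> inverse (real (Suc n))"
    by metis
  define C where "C = (real (card (carrier G)))\<^sup>2"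
  have bounds: "0 \<le> cp_norm G st \<alpha> (X n - x)" "cp_norm G st \<alpha> (X n - x) \<le> C * inverse (real (Suc n))" for n
    unfolding C_def using cp_norm_bounds[of "X n - x" "inverse (real (Suc n))"] X(2) by auto
  have "(\<lambda>n. C * inverse (real (Suc n))) \<longlonglongrightarrow> C * 0"
    by (rule tendsto_mult_left[OF LIMSEQ_inverse_real_of_nat])
  then have "(\<lambda>n. C * inverse (real (Suc n))) \<longlonglongrightarrow> 0" by (simp only: mult_zero_right)
  then have "(\<lambda>n. cp_norm G st \<alpha> (X n - x)) \<longlonglongrightarrow> 0"
    by (rule tendsto_sandwich[OF always_eventually always_eventually tendsto_const, rotated -1])
       (use bounds in simp_all)
  then show ?thesis using I X(1) x unfolding cp_ideal_def closed_ideal_def by blast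
qed

definition ideal_trace :: "('g \<Rightarrow> 'a) set \<Rightarrow> 'a set"
  where "ideal_trace I = {a. delta a \<one> \<in> I}"

lemma closed_ideal_trace:
  assumes I: "cp_ideal I"
  shows "closed_ideal UNIV scC (*) norm (ideal_trace I)"
proof -
  note ID = cp_idealD[OF I]
  have one: "delta a \<one> \<in> cp_carrier G" for a by (rule delta_in_cp_carrier) simp
  have mult: "cp_mult G \<alpha> (delta a \<one>) (delta b \<one>) = delta (a * b) \<one>" for a b
    unfolding cp_mult_delta_left[OF one] by (auto simp: delta_def)
  have "x \<in> ideal_trace I"
    if X: "\<And>n. X n \<in> ideal_trace I" and lim: "(\<lambda>n. norm (X n - x)) \<longlonglongrightarrow> 0" for X x
    unfolding ideal_trace_def mem_Collect_eq
  proof (rule cp_ideal_limit[OF I one])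
    fix e :: real assume "0 < e"
    then obtain n where n: "norm (X n - x) < e"
      using lim by (force simp: lim_sequentially)
    then show "\<exists>y\<in>I. \<forall>h\<in>carrier G. norm (y h - delta x \<one> h) \<le> e"
      using X[of n] \<open>0 < e\<close> unfolding ideal_trace_def
      by (intro bexI[of _ "delta (X n) \<one>"]) (auto simp: delta_def)
  qed
  moreover have "delta 0 \<one> = (0 :: 'g \<Rightarrow> 'a)" by (auto simp: delta_def)
  ultimately show ?thesis
    unfolding closed_ideal_def
    using ID(2) ID(3) ID(4)[of "delta _ \<one>"] ID(5)[OF one] ID(6)[OF one]
    by (auto simp: ideal_trace_def delta_add simp flip: mult cp_scale_delta)
qed

text \<open>Evaluation at \<open>\<one>\<close> is linear and maps onto the coefficient algebra, so
  it carries a finite spanning set to a finite spanning set.\<close>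

lemma fin_codim_zero_of_crossed_product:
  assumes "fin_codim (cp_scale scC) (cp_carrier G) {0}"
  shows "fin_codim scC UNIV {0}"
proof -
  obtain S where S: "finite S"
      "\<And>f. f \<in> cp_carrier G \<Longrightarrow> \<exists>c. f = (\<Sum>s\<in>S. cp_scale scC (c s) s)"
    using assms unfolding fin_codim_def by auto
  show ?thesis
  proof (rule fin_codimI[where K = S and v = "\<lambda>s. s \<one>"])
    fix a :: 'a
    obtain c where "delta a \<one> = (\<Sum>s\<in>S. cp_scale scC (c s) s)"
      using S(2)[OF delta_in_cp_carrier[OF one_closed]] by (rule exE)
    then have "delta a \<one> \<one> = (\<Sum>s\<in>S. cp_scale scC (c s) s) \<one>" by simp
    then have "a = (\<Sum>s\<in>S. scC (c s) (s \<one>))" by (simp add: delta_def sum_fun_apply cp_scale_def)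
    then show "\<exists>c. \<exists>y\<in>{0}. a = (\<Sum>s\<in>S. scC (c s) (s \<one>)) + y" by auto
  qed (use S scC_add_left in auto)
qed

end

section \<open>Consequences of the Rokhlin property\<close>

locale rokhlin_crossed_product = crossed_product scC st G \<alpha>
  for scC :: "complex \<Rightarrow> 'a::{real_normed_algebra,banach} \<Rightarrow> 'a" and st :: "'a \<Rightarrow> 'a"
    and G :: "('g, 'm) monoid_scheme" (structure) and \<alpha> :: "'g \<Rightarrow> 'a \<Rightarrow> 'a" +
  assumes rok: "rokhlin G st \<alpha>"
begin

lemma rokhlinE:
  assumes "0 < e" "finite F"
  obtains r where
    "\<And>g. g \<in> carrier G \<Longrightarrow> norm (r g) \<le> 1"
    "\<And>g h. g \<in> carrier G \<Longrightarrow> h \<in> carrier G \<Longrightarrow> g \<noteq> h \<Longrightarrow> r g * r h = 0"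
    "\<And>g h. g \<in> carrier G \<Longrightarrow> h \<in> carrier G \<Longrightarrow> norm (\<alpha> g (r h) - r (g \<otimes> h)) < e"
    "\<And>a g. a \<in> F \<Longrightarrow> g \<in> carrier G \<Longrightarrow> norm (r g * a - a * r g) < e"
    "\<And>a. a \<in> F \<Longrightarrow> norm ((\<Sum>g\<in>carrier G. r g) * a - a) < e"
proof -
  obtain r where r: "(\<forall>g\<in>carrier G. positive st (r g) \<and> norm (r g) \<le> 1) \<and>
      (\<forall>g\<in>carrier G. \<forall>h\<in>carrier G. g \<noteq> h \<longrightarrow> r g * r h = 0) \<and>
      (\<forall>g\<in>carrier G. \<forall>h\<in>carrier G. norm (\<alpha> g (r h) - r (g \<otimes> h)) < e) \<and>
      (\<forall>a\<in>F. \<forall>g\<in>carrier G. norm (r g * a - a * r g) < e) \<and>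
      (\<forall>a\<in>F. norm ((\<Sum>g\<in>carrier G. r g) * a - a) < e)"
    using rok[unfolded rokhlin_def, THEN spec, THEN mp, OF assms(1), THEN spec, THEN mp, OF assms(2)]
    by (rule exE)
  show thesis by (rule that[of r]; use r in meson)
qed

text \<open>As a unit may be missing, \<open>delta y \<one>\<close> is multiplied by
  \<open>delta u g\<close>, where \<open>u\<close> is the sum of a Rokhlin family. The family
  controls \<open>u * y - y\<close>, and approximate commutation transfers this to
  \<open>y * u - y\<close>.\<close>

lemma delta_in_ideal:
  assumes I: "cp_ideal I" and y: "y \<in> ideal_trace I" and g: "g \<in> carrier G"
  shows "delta y g \<in> I"
proof (rule cp_ideal_limit[OF I delta_in_cp_carrier[OF g]])
  fix e :: real assume e: "0 < e"
  define n where "n = real (card (carrier G)) + 1"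
  have n: "0 < n" by (simp add: n_def add_nonneg_pos)
  obtain r where r: "\<And>h. h \<in> carrier G \<Longrightarrow> norm (r h * y - y * r h) < e / n"
      "norm ((\<Sum>h\<in>carrier G. r h) * y - y) < e / n"
    using rokhlinE[of "e / n" "{y}"] e n by (smt (verit) divide_pos_pos finite.intros singletonI)
  define u where "u = (\<Sum>h\<in>carrier G. r h)"
  have "norm (u * y - y * u) \<le> (\<Sum>h\<in>carrier G. e / n)"
    unfolding u_def sum_distrib_left sum_distrib_right sum_subtractf[symmetric]
    using r(1) by (intro sum_norm_le) (auto intro: less_imp_le)
  moreover have "y * u - y = (u * y - y) - (u * y - y * u)" by simp
  ultimately have "norm (y * u - y) \<le> e / n + card (carrier G) * (e / n)"
    using r(2) norm_triangle_ineq4[of "u * y - y" "u * y - y * u"] by (simp add: u_def)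
  also have "\<dots> = n * (e / n)" by (simp only: n_def distrib_right mult_1 add.commute)
  also have "\<dots> = e" using n by simp
  finally have yu: "norm (y * u - y) \<le> e" .
  have "cp_mult G \<alpha> (delta y \<one>) (delta u g) \<in> I"
    using y cp_idealD(6)[OF I delta_in_cp_carrier[OF g]] by (simp add: ideal_trace_def)
  moreover have "cp_mult G \<alpha> (delta y \<one>) (delta u g) = delta (y * u) g"
    unfolding cp_mult_delta_left[OF delta_in_cp_carrier[OF g]] by (auto simp: delta_def)
  ultimately show "\<exists>z\<in>I. \<forall>h\<in>carrier G. norm (z h - delta y g h) \<le> e"
    using yu e by (intro bexI[of _ "delta (y * u) g"]) (auto simp: delta_def)
qed

text \<open>The averages \<open>\<Sum>g. r\<^sub>g f r\<^sub>g\<close> tend to \<open>f(1)\<close>: the coefficient at \<open>x\<close> is close to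
  \<open>\<Sum>g. f(x) r\<^sub>g r\<^sub>x\<^sub>g\<close>, which vanishes for \<open>x \<noteq> 1\<close>.\<close>

lemma coefficient_one_in_trace:
  assumes I: "cp_ideal I" and f: "f \<in> I"
  shows "f \<one> \<in> ideal_trace I"
  unfolding ideal_trace_def mem_Collect_eq
proof (rule cp_ideal_limit[OF I])
  let ?R = "carrier G"
  have one: "delta a \<one> \<in> cp_carrier G" for a by (rule delta_in_cp_carrier) simp
  show "delta (f \<one>) \<one> \<in> cp_carrier G" by (rule one)
  have fC: "f \<in> cp_carrier G" using f cp_idealD(1)[OF I] by blast
  fix e :: real assume e: "0 < e"
  define n where "n = real (card ?R)"
  define M where "M = (\<Sum>x\<in>?R. norm (f x))"
  have M: "norm (f x) \<le> M" if "x \<in> ?R" for x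
    unfolding M_def using that fin by (intro member_le_sum) auto
  have M0: "0 \<le> M" unfolding M_def by (intro sum_nonneg) simp
  \<comment> \<open>Chosen to dominate both errors below: \<open>n * (M + 1) * d\<close> away from
    \<open>\<one>\<close> and \<open>(2 * n + 1) * d\<close> at \<open>\<one>\<close>.\<close>
  define d where "d = e / (n * (M + 2) + 1)"
  have n0: "0 \<le> n" by (simp add: n_def)
  have D: "0 < n * (M + 2) + 1" using M0 n0 by (intro add_nonneg_pos mult_nonneg_nonneg) auto
  have d: "0 < d" using e D by (simp add: d_def)
  obtain r where r: "\<And>g. g \<in> ?R \<Longrightarrow> norm (r g) \<le> 1"
    "\<And>g h. g \<in> ?R \<Longrightarrow> h \<in> ?R \<Longrightarrow> g \<noteq> h \<Longrightarrow> r g * r h = 0"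
    "\<And>g h. g \<in> ?R \<Longrightarrow> h \<in> ?R \<Longrightarrow> norm (\<alpha> g (r h) - r (g \<otimes> h)) < d"
    "\<And>a g. a \<in> f ` ?R \<Longrightarrow> g \<in> ?R \<Longrightarrow> norm (r g * a - a * r g) < d"
    "\<And>a. a \<in> f ` ?R \<Longrightarrow> norm ((\<Sum>g\<in>?R. r g) * a - a) < d"
    using rokhlinE[OF d finite_imageI[OF fin, of f]] by blast
  define y where "y = (\<Sum>g\<in>?R. cp_mult G \<alpha> (delta (r g) \<one>) (cp_mult G \<alpha> f (delta (r g) \<one>)))"
  have yI: "y \<in> I" unfolding y_def by (intro cp_ideal_sum[OF I] cp_idealD(5,6)[OF I] one f)
  have fr: "cp_mult G \<alpha> f (delta (r g) \<one>) \<in> cp_carrier G" for g by (simp add: cp_mult_def cp_carrier_def)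
  have y: "y x = (\<Sum>g\<in>?R. r g * (f x * \<alpha> x (r g)))" if x: "x \<in> ?R" for x
    unfolding y_def sum_fun_apply cp_mult_delta_left[OF fr] using x by (simp add: cp_mult_delta_right)
  have mm: "norm (a * b) \<le> p * q" if "norm a \<le> p" "norm b \<le> q" for a b :: 'a and p q :: real
    using that order_trans[OF norm_ge_zero that(1)] by (intro order_trans[OF norm_mult_ineq mult_mono]) auto
  have off: "norm (y x) \<le> e" if x: "x \<in> ?R" "x \<noteq> \<one>" for x
  proof -
    have "norm (r g * (f x * \<alpha> x (r g))) \<le> M * d + d" if g: "g \<in> ?R" for g
    proof -
      have "x \<otimes> g \<noteq> g" using x g by simp
      then have "r g * r (x \<otimes> g) = 0" using x g by (intro r(2)) auto
      \<comment> \<open>One error comes from replacing \<open>\<alpha> x (r g)\<close> by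
        \<open>r (x \<otimes> g)\<close>, the other from moving \<open>r g\<close> past
        \<open>f x\<close>; the remaining term contains
        \<open>r g * r (x \<otimes> g) = 0\<close>.\<close>
      then have "r g * (f x * \<alpha> x (r g))
          = r g * (f x * (\<alpha> x (r g) - r (x \<otimes> g))) + (r g * f x - f x * r g) * r (x \<otimes> g)"
        by (simp add: left_diff_distrib right_diff_distrib mult.assoc)
      moreover have "norm (r g * (f x * (\<alpha> x (r g) - r (x \<otimes> g)))) \<le> 1 * (M * d)"
        using x g r(3)[of x g] by (intro mm r(1) M) auto
      moreover have "norm ((r g * f x - f x * r g) * r (x \<otimes> g)) \<le> d * 1"
        using x g r(4)[of "f x" g] by (intro mm r(1)) auto
      ultimately show ?thesis by (simp only:) (rule norm_triangle_mono, simp_all)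
    qed
    then have "norm (y x) \<le> (\<Sum>g\<in>?R. M * d + d)" unfolding y[OF x(1)] by (intro sum_norm_le)
    also have "\<dots> = n * (M + 1) * d" by (simp add: n_def algebra_simps)
    also have "\<dots> \<le> (n * (M + 2) + 1) * d" using d n0 by (intro mult_right_mono) (auto simp: algebra_simps)
    also have "\<dots> = e" using D by (simp add: d_def)
    finally show ?thesis .
  qed
  have on: "norm (y \<one> - f \<one>) \<le> e"
  proof -
    let ?a = "f \<one>"
    define u where "u = (\<Sum>g\<in>?R. r g)"
    have a: "?a \<in> f ` ?R" by simp
    have un: "norm u \<le> n"
      unfolding u_def n_def using sum_norm_le[of ?R r "\<lambda>_. 1"] r(1) by simp
    \<comment> \<open>Orthogonality reduces \<open>u * u\<close> to the sum of squares, so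
      \<open>y \<one>\<close> can be compared with \<open>u * (u * f \<one>)\<close>, which is close
      to \<open>f \<one>\<close>.\<close>
    have "u * u = (\<Sum>g\<in>?R. \<Sum>h\<in>?R. r g * r h)" unfolding u_def by (rule sum_product)
    also have "\<dots> = (\<Sum>g\<in>?R. \<Sum>h\<in>?R. if h = g then r g * r g else 0)"
      by (intro sum.cong refl) (auto simp: r(2))
    also have "\<dots> = (\<Sum>g\<in>?R. r g * r g)" by (intro sum.cong refl) (simp add: sum.delta' fin)
    finally have uu: "u * u = (\<Sum>g\<in>?R. r g * r g)" .
    have "y \<one> - u * (u * ?a) = (\<Sum>g\<in>?R. r g * (?a * r g - r g * ?a))"
      unfolding y[OF one_closed] mult.assoc[symmetric] uu sum_distrib_right sum_subtractf[symmetric]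
      by (simp add: right_diff_distrib mult.assoc)
    also have "norm \<dots> \<le> (\<Sum>g\<in>?R. 1 * d)"
      using r(4)[OF a] by (intro sum_norm_le mm r(1)) (auto simp: norm_minus_commute less_imp_le)
    finally have 1: "norm (y \<one> - u * (u * ?a)) \<le> n * d" by (simp add: n_def)
    have ua: "norm (u * ?a - ?a) \<le> d" using r(5)[OF a] by (simp add: u_def)
    have 2: "norm (u * (u * ?a - ?a)) \<le> n * d" by (intro mm un ua)
    have "y \<one> - ?a = (y \<one> - u * (u * ?a)) + u * (u * ?a - ?a) + (u * ?a - ?a)"
      by (simp add: right_diff_distrib)
    then have "norm (y \<one> - ?a) \<le> n * d + n * d + d" using 1 2 ua by (metis norm_triangle_mono)
    also have "\<dots> \<le> (n * (M + 2) + 1) * d" using d n0 M0 by (simp add: algebra_simps)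
    also have "\<dots> = e" using D by (simp add: d_def)
    finally show ?thesis .
  qed
  show "\<exists>y\<in>I. \<forall>h\<in>?R. norm (y h - delta (f \<one>) \<one> h) \<le> e"
    using yI on off by (intro bexI[of _ y]) (auto simp: delta_def)
qed

text \<open>A nonzero \<open>f\<close> may vanish at \<open>\<one>\<close>. If
  \<open>f k \<noteq> 0\<close>, right multiplication by \<open>delta b (inv k)\<close> moves this
  coefficient to \<open>\<one>\<close>, and \<open>b\<close> is chosen so that it becomes
  \<open>f k * st (f k)\<close>.\<close>

lemma trace_nonzero:
  assumes I: "cp_ideal I" and nz: "I \<noteq> {0}"
  shows "ideal_trace I \<noteq> {0}"
proof -
  obtain f where f: "f \<in> I" "f \<noteq> 0" using nz cp_idealD(2)[OF I] by blast
  then obtain k where k: "f k \<noteq> 0" by (auto simp: fun_eq_iff)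
  have kG: "k \<in> carrier G" using k f cp_idealD(1)[OF I] by (auto simp: cp_carrier_def)
  define b where "b = \<alpha> (inv k) (st (f k))"
  define F where "F = cp_mult G \<alpha> f (delta b (inv k))"
  have "F \<in> I" unfolding F_def using f kG by (intro cp_idealD(6)[OF I] delta_in_cp_carrier) auto
  then have "F \<one> \<in> ideal_trace I" by (rule coefficient_one_in_trace[OF I])
  moreover have "F \<one> = f k * st (f k)"
    unfolding F_def using kG by (simp add: cp_mult_delta_right b_def flip: \<alpha>_comp)
  then have "F \<one> \<noteq> 0" using norm_st_mult[of "st (f k)"] k by auto
  ultimately show ?thesis by auto
qed

text \<open>Each coefficient is expanded over the finite set \<open>S\<close> modulo
  \<open>ideal_trace I\<close>. The remainders, placed at their group elements, stay in
  \<open>I\<close> by \<open>delta_in_ideal\<close>, so the functions \<open>delta s g\<close> span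
  modulo \<open>I\<close>.\<close>

lemma fin_codim_if_trace:
  assumes I: "cp_ideal I" and tr: "fin_codim scC UNIV (ideal_trace I)"
  shows "fin_codim (cp_scale scC) (cp_carrier G) I"
proof -
  let ?R = "carrier G"
  obtain S where S: "finite S" "\<And>x. \<exists>c. \<exists>y\<in>ideal_trace I. x = (\<Sum>s\<in>S. scC (c s) s) + y"
    using tr unfolding fin_codim_def by auto
  show ?thesis
  proof (rule fin_codimI[where K = "?R \<times> S" and v = "\<lambda>(g, s). delta s g"])
    show "finite (?R \<times> S)" using fin S by simp
    show "\<And>k. k \<in> ?R \<times> S \<Longrightarrow> (case k of (g, s) \<Rightarrow> delta s g) \<in> cp_carrier G"
      by (auto intro: delta_in_cp_carrier)
    show "\<And>c d x. cp_scale scC (c + d) x = cp_scale scC c x + cp_scale scC d x"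
      by (auto simp: cp_scale_def scC_add_left)
    fix f :: "'g \<Rightarrow> 'a" assume f: "f \<in> cp_carrier G"
    obtain c y where cy: "\<And>g. y g \<in> ideal_trace I" "\<And>g. f g = (\<Sum>s\<in>S. scC (c g s) s) + y g"
    proof -
      have "\<forall>g. \<exists>c y. y \<in> ideal_trace I \<and> f g = (\<Sum>s\<in>S. scC (c s) s) + y"
        using S(2) by blast
      then obtain c where "\<forall>g. \<exists>y. y \<in> ideal_trace I \<and> f g = (\<Sum>s\<in>S. scC (c g s) s) + y"
        by (rule choice[THEN exE])
      then obtain y where "\<forall>g. y g \<in> ideal_trace I \<and> f g = (\<Sum>s\<in>S. scC (c g s) s) + y g"
        by (rule choice[THEN exE])
      then show thesis by (intro that[of y c]) simp_all
    qed
    define z where "z = (\<Sum>g\<in>?R. delta (y g) g)"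
    have z: "z \<in> I" unfolding z_def by (intro cp_ideal_sum[OF I] delta_in_ideal[OF I] cy(1))
    have "f = (\<Sum>(g, s)\<in>?R \<times> S. cp_scale scC (c g s) (delta s g)) + z"
    proof
      fix x
      have 1: "(\<Sum>g\<in>?R. delta (w g) g x) = (if x \<in> ?R then w x else 0)" for w :: "_ \<Rightarrow> 'a"
        using fin by (simp add: delta_def sum.delta)
      have "(\<Sum>(g, s)\<in>?R \<times> S. cp_scale scC (c g s) (delta s g)) x
          = (\<Sum>g\<in>?R. \<Sum>s\<in>S. delta (scC (c g s) s) g x)"
        by (simp add: sum_fun_apply sum.cartesian_product cp_scale_delta case_prod_unfold)
      also have "\<dots> = (\<Sum>g\<in>?R. delta (\<Sum>s\<in>S. scC (c g s) s) g x)"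
        by (intro sum.cong refl) (auto simp: delta_def)
      finally show "f x = ((\<Sum>(g, s)\<in>?R \<times> S. cp_scale scC (c g s) (delta s g)) + z) x"
        using f by (cases "x \<in> ?R") (simp_all add: z_def sum_fun_apply 1 cp_carrier_def flip: cy(2))
    qed
    then show "\<exists>c. \<exists>y\<in>I. f = (\<Sum>k\<in>?R \<times> S. cp_scale scC (c k) (case k of (g, s) \<Rightarrow> delta s g)) + y"
      using z by (intro exI[of _ "\<lambda>(g, s). c g s"] bexI[of _ z]) (simp_all add: case_prod_unfold)
  qed
qed

end

theorem theorem2p27:
  fixes G :: "('g, 'm) monoid_scheme"
    and scC :: "complex \<Rightarrow> 'a::{real_normed_algebra,banach} \<Rightarrow> 'a"
    and st :: "'a \<Rightarrow> 'a"
    and \<alpha> :: "'g \<Rightarrow> 'a \<Rightarrow> 'a"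
  assumes "cstar_algebra scC st"
    and "just_infinite (UNIV :: 'a set) scC (*) norm"
    and "group G" and "finite (carrier G)"
    and "cstar_action G scC st \<alpha>"
    and "rokhlin G st \<alpha>"
  shows "just_infinite (cp_carrier G) (cp_scale scC) (cp_mult G \<alpha>) (cp_norm G st \<alpha>)"
proof -
  interpret group G by fact
  interpret rokhlin_crossed_product scC st G \<alpha>
    by unfold_locales fact+
  show ?thesis
    unfolding just_infinite_def cp_ideal_def[symmetric]
  proof (intro conjI allI impI)
    show "\<not> fin_codim (cp_scale scC) (cp_carrier G) {0}"
      using assms(2)[unfolded just_infinite_def, THEN conjunct1]
      by (rule contrapos_nn) (rule fin_codim_zero_of_crossed_product)
    fix I assume I: "cp_ideal I \<and> I \<noteq> {0}"
    then have "closed_ideal UNIV scC (*) norm (ideal_trace I) \<and> ideal_trace I \<noteq> {0}"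
      by (intro conjI closed_ideal_trace trace_nonzero) simp_all
    then have "fin_codim scC UNIV (ideal_trace I)"
      by (rule assms(2)[unfolded just_infinite_def, THEN conjunct2, THEN spec, THEN mp])
    then show "fin_codim (cp_scale scC) (cp_carrier G) I"
      by (rule fin_codim_if_trace[OF conjunct1[OF I]])
  qed
qed

end
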